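(* Let $(W,\mathcal{S})$ be a finite Coxeter system and $m\ge 0$ an integer. The $m$-weak order $\mathrm{Weak}^{(m)}(W)=[e,w_\circ^m]$ (an interval in the right weak order of the positive Artin monoid $B^+(W)$) is a lattice which is rank-symmetric and self-dual (i.e. anti-isomorphic to itself).
   Context: $(W,\mathcal{S})$ is a finite Coxeter system with Coxeter matrix $m(s,t)$. The positive Artin monoid $B^+=B^+(W)$ is the monoid generated by (a formal copy of) $\mathcal{S}$ subject only to the braid relations $sts\cdots=tst\cdots$ (both sides with $m(s,t)$ factors) for $s\ne t$. All words representing a given $w\in B^+$ have the same length $\ell(w)$. The right weak order on $B^+$ is $u\le w$ iff there is $v\in B^+$ with $uv=w$ (then $\ell(u)+\ell(v)=\ell(w)$). $w_\circ$ denotes the longest element of $W$, viewed in $B^+$ via any reduced word; $N=\ell(w_\circ)$. $\mathrm{Weak}^{(m)}(W)$ is the interval $\{w\in B^+: w\le w_\circ^m\}$ with the induced order; it is graded by $\ell$ with ranks $0,\dots,mN$, and rank-symmetric means the number of elements of length $i$ equals the number of elements of length $mN-i$ for all $i$. *)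

theory Defs
  imports "HOL-Algebra.Multiplicative_Group" "HOL-Algebra.Lattice"
begin

text \<open>Monoids presented by generators \<open>S\<close> and relations \<open>R\<close>, as congruence classes of words over \<open>S\<close>.\<close>

inductive_set word_cong :: "'a set \<Rightarrow> ('a list \<times> 'a list) set \<Rightarrow> ('a list \<times> 'a list) set"
  for S :: "'a set" and R :: "('a list \<times> 'a list) set"
where
  rel: "\<lbrakk>(x, y) \<in> R; x \<in> lists S; y \<in> lists S; u \<in> lists S; v \<in> lists S\<rbrakk>
          \<Longrightarrow> (u @ x @ v, u @ y @ v) \<in> word_cong S R"
| refl: "u \<in> lists S \<Longrightarrow> (u, u) \<in> word_cong S R"
| sym: "(u, v) \<in> word_cong S R \<Longrightarrow> (v, u) \<in> word_cong S R"
| trans: "\<lbrakk>(u, v) \<in> word_cong S R; (v, w) \<in> word_cong S R\<rbrakk> \<Longrightarrow> (u, w) \<in> word_cong S R"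

definition presented_monoid :: "'a set \<Rightarrow> ('a list \<times> 'a list) set \<Rightarrow> 'a list set monoid" where
  "presented_monoid S R =
     \<lparr>carrier = lists S // word_cong S R,
      monoid.mult = (\<lambda>X Y. \<Union>x\<in>X. \<Union>y\<in>Y. word_cong S R `` {x @ y}),
      one = word_cong S R `` {[]}\<rparr>"

definition word_prod :: "('a, 'b) monoid_scheme \<Rightarrow> 'a list \<Rightarrow> 'a" where
  "word_prod W ws = foldr (\<otimes>\<^bsub>W\<^esub>) ws \<one>\<^bsub>W\<^esub>"

text \<open>The entry \<open>m(s,t)\<close> of the Coxeter matrix is the order of \<open>st\<close>. The library function
  \<open>ord\<close> is \<open>0\<close> on elements of infinite order, so \<open>0\<close> stands for \<open>\<infinity>\<close>; the Coxeter and
  braid relations for such a pair then read \<open>[] = []\<close> and impose nothing.\<close>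

definition coxeter_mat :: "('a, 'b) monoid_scheme \<Rightarrow> 'a \<Rightarrow> 'a \<Rightarrow> nat" where
  "coxeter_mat W s t = group.ord W (s \<otimes>\<^bsub>W\<^esub> t)"

definition coxeter_rels :: "('a, 'b) monoid_scheme \<Rightarrow> 'a set \<Rightarrow> ('a list \<times> 'a list) set" where
  "coxeter_rels W S =
     {(concat (replicate (coxeter_mat W s t) [s, t]), []) | s t. s \<in> S \<and> t \<in> S}"

text \<open>\<open>W\<close> is the group presented by generators \<open>S\<close> and relations \<open>(st)^m(s,t) = 1\<close>. Words without
  formal inverses suffice, since the case \<open>s = t\<close> of the relations is \<open>ss = 1\<close>.\<close>

locale coxeter_system = group W for W (structure) +
  fixes S :: "'a set"
  assumes gens_closed: "S \<subseteq> carrier W"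
    and gens_order: "s \<in> S \<Longrightarrow> ord s = 2"
    and gens_generate: "generate W S = carrier W"
    and presentation: "\<lbrakk>u \<in> lists S; v \<in> lists S\<rbrakk> \<Longrightarrow>
      word_prod W u = word_prod W v \<longleftrightarrow> (u, v) \<in> word_cong S (coxeter_rels W S)"

definition coxeter_length :: "('a, 'b) monoid_scheme \<Rightarrow> 'a set \<Rightarrow> 'a \<Rightarrow> nat" where
  "coxeter_length W S w = (LEAST n. \<exists>ws \<in> lists S. length ws = n \<and> word_prod W ws = w)"

definition reduced_word :: "('a, 'b) monoid_scheme \<Rightarrow> 'a set \<Rightarrow> 'a list \<Rightarrow> 'a \<Rightarrow> bool" where
  "reduced_word W S ws w \<longleftrightarrow>
     ws \<in> lists S \<and> word_prod W ws = w \<and> length ws = coxeter_length W S w"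

definition longest_element :: "('a, 'b) monoid_scheme \<Rightarrow> 'a set \<Rightarrow> 'a" where
  "longest_element W S =
     (THE w. w \<in> carrier W \<and> (\<forall>v \<in> carrier W. coxeter_length W S v \<le> coxeter_length W S w))"

fun alternating :: "nat \<Rightarrow> 'a \<Rightarrow> 'a \<Rightarrow> 'a list" where
  "alternating 0 s t = []"
| "alternating (Suc n) s t = s # alternating n t s"

definition braid_rels :: "('a, 'b) monoid_scheme \<Rightarrow> 'a set \<Rightarrow> ('a list \<times> 'a list) set" where
  "braid_rels W S =
     {(alternating (coxeter_mat W s t) s t, alternating (coxeter_mat W s t) t s)
       | s t. s \<in> S \<and> t \<in> S \<and> s \<noteq> t}"

definition artin_monoid :: "('a, 'b) monoid_scheme \<Rightarrow> 'a set \<Rightarrow> 'a list set monoid" where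
  "artin_monoid W S = presented_monoid S (braid_rels W S)"

text \<open>The common length of all words representing an element of the Artin monoid.\<close>

definition artin_length :: "'a list set \<Rightarrow> nat" where
  "artin_length b = (THE n. \<forall>ws \<in> b. length ws = n)"

text \<open>The element of the Artin monoid represented by any reduced word of \<open>w\<close>; by Matsumoto's
  theorem it does not depend on the reduced word.\<close>

definition artin_lift :: "('a, 'b) monoid_scheme \<Rightarrow> 'a set \<Rightarrow> 'a \<Rightarrow> 'a list set" where
  "artin_lift W S w =
     (THE b. \<exists>ws. reduced_word W S ws w \<and> b = word_cong S (braid_rels W S) `` {ws})"

definition weak_le :: "('a, 'b) monoid_scheme \<Rightarrow> 'a set \<Rightarrow> 'a list set \<Rightarrow> 'a list set \<Rightarrow> bool" where
  "weak_le W S u w \<longleftrightarrow>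
     (\<exists>v \<in> carrier (artin_monoid W S). u \<otimes>\<^bsub>artin_monoid W S\<^esub> v = w)"

definition m_weak_order :: "('a, 'b) monoid_scheme \<Rightarrow> 'a set \<Rightarrow> nat \<Rightarrow> 'a list set gorder" where
  "m_weak_order W S m =
     \<lparr>carrier = {w \<in> carrier (artin_monoid W S).
         weak_le W S w (artin_lift W S (longest_element W S) [^]\<^bsub>artin_monoid W S\<^esub> m)},
      eq = (=),
      le = weak_le W S\<rparr>"

definition rank_symmetric :: "('a, 'b) gorder_scheme \<Rightarrow> ('a \<Rightarrow> nat) \<Rightarrow> nat \<Rightarrow> bool" where
  "rank_symmetric L rk n \<longleftrightarrow>
     (\<forall>i \<le> n. card {x \<in> carrier L. rk x = i} = card {x \<in> carrier L. rk x = n - i})"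

definition self_dual :: "('a, 'b) gorder_scheme \<Rightarrow> bool" where
  "self_dual L \<longleftrightarrow>
     (\<exists>f. bij_betw f (carrier L) (carrier L) \<and>
          (\<forall>x \<in> carrier L. \<forall>y \<in> carrier L. x \<sqsubseteq>\<^bsub>L\<^esub> y \<longleftrightarrow> f y \<sqsubseteq>\<^bsub>L\<^esub> f x))"

end

(*
  Working with words, the inversion set of a group element is well defined by the presentation, and
  the weak order on W is inclusion of inversion sets. The part of z inside a dihedral parabolic
  subgroup shows that s, t <= z forces the alternating element of length m(s,t) below z; from this local statement and the existence of a
  longest element, joins exist in W, and Matsumoto's theorem follows.

  In the Artin monoid, Garside's argument shows by induction on the length that aX = bY implies
  X = (aK)R and Y = (bK)R for some simple K above both a and b; to glue two such factorisations one
  uses that the simple left divisors of a shorter element are closed under joins of W. The case a = b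
  is left cancellation. Bounded pairs then have least common multiples by the same induction that
  gave joins in W. Finally the reversal of words fixes the power of the longest element, so sending
  u, where uz is that power, to the reversal of z is an order-reversing involution; it turns joins
  into meets and lengths l into mN - l.
*)

theory Submission
  imports Defs
begin

text \<open>No root system or geometric representation is used. Each letter of a word contributes a
  reflection; the reflections occurring an odd number of times depend only on the group element,
  because a Coxeter relator contributes every reflection an even number of times. Length, deletion
  of letters and the weak order are all read off from these finite sets.

  In the Artin monoid there are no inverses to compute with, and equality is known only through
  derivations, so even left cancellation has to be earned. What remains available is the comparison
  of simple elements, the lifts of elements of W, by their inversion sets. The reduction statement
  asks for some simple K above both letters, not for a least one: along a derivation, two values of
  K can then be merged by a join in W, and such joins always exist since the longest element bounds
  everything. The cancellations needed while merging concern words for which the statement is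
  already known. That the join of two letters in W divides every common multiple of theirs is
  deduced only afterwards, by comparing it with K.\<close>

lemma (in group) inv_mult_cancel [simp]:
  "x \<in> carrier G \<Longrightarrow> y \<in> carrier G \<Longrightarrow> inv x \<otimes> (x \<otimes> y) = y"
  "x \<in> carrier G \<Longrightarrow> y \<in> carrier G \<Longrightarrow> x \<otimes> (inv x \<otimes> y) = y"
  by (simp_all flip: m_assoc)

definition (in group) conj_by :: "'a \<Rightarrow> 'a \<Rightarrow> 'a" where
  "conj_by g x = g \<otimes> x \<otimes> inv g"

context group
begin

lemma conj_by_closed [simp]: "g \<in> carrier G \<Longrightarrow> x \<in> carrier G \<Longrightarrow> conj_by g x \<in> carrier G"
  by (simp add: conj_by_def)

lemma conj_by_mult:
  "g \<in> carrier G \<Longrightarrow> h \<in> carrier G \<Longrightarrow> x \<in> carrier G \<Longrightarrow>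
    conj_by (g \<otimes> h) x = conj_by g (conj_by h x)"
  by (simp add: conj_by_def m_assoc inv_mult_group)

lemma conj_by_one [simp]: "x \<in> carrier G \<Longrightarrow> conj_by \<one> x = x"
  by (simp add: conj_by_def)

lemma conj_by_inv [simp]:
  "g \<in> carrier G \<Longrightarrow> x \<in> carrier G \<Longrightarrow> conj_by g (conj_by (inv g) x) = x"
  "g \<in> carrier G \<Longrightarrow> x \<in> carrier G \<Longrightarrow> conj_by (inv g) (conj_by g x) = x"
  by (simp_all add: conj_by_def m_assoc)

lemma conj_by_self [simp]: "g \<in> carrier G \<Longrightarrow> conj_by g g = g"
  by (simp add: conj_by_def m_assoc)

lemma inj_on_conj_by: "g \<in> carrier G \<Longrightarrow> A \<subseteq> carrier G \<Longrightarrow> inj_on (conj_by g) A"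
  by (intro inj_on_inverseI[of _ "conj_by (inv g)"]) auto

lemma conj_by_mem_image:
  assumes "g \<in> carrier G" "x \<in> carrier G" "A \<subseteq> carrier G"
  shows "x \<in> conj_by g ` A \<longleftrightarrow> conj_by (inv g) x \<in> A"
proof
  assume "conj_by (inv g) x \<in> A"
  then have "conj_by g (conj_by (inv g) x) \<in> conj_by g ` A" by (rule imageI)
  then show "x \<in> conj_by g ` A" using assms by simp
qed (use assms in auto)

end

section \<open>Alternating words\<close>

lemma alternating_lists: "s \<in> A \<Longrightarrow> t \<in> A \<Longrightarrow> alternating n s t \<in> lists A"
  by (induction n arbitrary: s t) auto

lemma length_alternating [simp]: "length (alternating n s t) = n"
  by (induction n arbitrary: s t) auto

lemma alternating_add:
  "alternating (m + n) s t =
    alternating m s t @ (if even m then alternating n s t else alternating n t s)"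
  by (induction m arbitrary: s t) auto

lemma rev_alternating:
  "rev (alternating n s t) = (if even n then alternating n t s else alternating n s t)"
proof (induction n arbitrary: s t)
  case (Suc n)
  have "alternating (Suc n) a b = alternating n a b @ (if even n then [a] else [b])" for a b :: 'a
    using alternating_add[of n 1 a b] by simp
  then show ?case
    using Suc by (metis alternating.simps(2) even_Suc rev.simps(2))
qed simp

lemma concat_replicate_alternating: "concat (replicate n [s, t]) = alternating (2 * n) s t"
  by (induction n) auto

section \<open>Inversion sets\<close>

context coxeter_system
begin

lemma gen_carrier [simp]: "s \<in> S \<Longrightarrow> s \<in> carrier W"
  using gens_closed by blast

lemma gen_sq [simp]: "s \<in> S \<Longrightarrow> s \<otimes> s = \<one>"
  using pow_ord_eq_1[of s] by (simp add: gens_order numeral_2_eq_2)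

lemma gen_inv [simp]: "s \<in> S \<Longrightarrow> inv s = s"
  by (simp add: inv_equality)

lemma gen_cancel [simp]: "s \<in> S \<Longrightarrow> x \<in> carrier W \<Longrightarrow> s \<otimes> (s \<otimes> x) = x"
  by (simp flip: m_assoc)

lemma word_prod_Nil [simp]: "word_prod W [] = \<one>"
  by (simp add: word_prod_def)

lemma word_prod_Cons [simp]: "word_prod W (s # ws) = s \<otimes> word_prod W ws"
  by (simp add: word_prod_def)

lemma word_prod_closed [simp]: "ws \<in> lists S \<Longrightarrow> word_prod W ws \<in> carrier W"
  by (induction ws) auto

lemma word_prod_append [simp]:
  "u \<in> lists S \<Longrightarrow> v \<in> lists S \<Longrightarrow> word_prod W (u @ v) = word_prod W u \<otimes> word_prod W v"
  by (induction u) (auto simp: m_assoc)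

lemma word_prod_rev: "ws \<in> lists S \<Longrightarrow> word_prod W (rev ws) = inv (word_prod W ws)"
proof (induction ws)
  case (Cons s ws)
  then have "word_prod W (rev (s # ws)) = word_prod W (rev ws) \<otimes> word_prod W [s]"
    unfolding rev.simps by (intro word_prod_append) auto
  then show ?case using Cons by (auto simp: inv_mult_group)
qed simp

lemma word_exists:
  assumes "w \<in> carrier W"
  shows "\<exists>ws \<in> lists S. word_prod W ws = w"
proof -
  have "w \<in> generate W S" using assms gens_generate by simp
  then show ?thesis
  proof (induction rule: generate.induct)
    case one then show ?case by (intro bexI[of _ "[]"]) auto
  next
    case (incl h) then show ?case by (intro bexI[of _ "[h]"]) auto
  next
    case (inv h) then show ?case by (intro bexI[of _ "[h]"]) auto
  next
    case (eng h1 h2) then show ?case by (metis append_in_lists_conv word_prod_append)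
  qed
qed

text \<open>For a word s_1 ... s_n the i-th entry is s_i conjugated by s_1 ... s_{i-1}. Multiplying
  the product of the word on the left by this entry deletes the i-th letter.\<close>

primrec reflections :: "'a list \<Rightarrow> 'a list" where
  "reflections [] = []"
| "reflections (s # ws) = s # map (conj_by s) (reflections ws)"

lemma length_reflections [simp]: "length (reflections ws) = length ws"
  by (induction ws) auto

lemma reflections_carrier: "ws \<in> lists S \<Longrightarrow> set (reflections ws) \<subseteq> carrier W"
  by (induction ws) auto

lemma reflections_append:
  assumes "u \<in> lists S" "v \<in> lists S"
  shows "reflections (u @ v) = reflections u @ map (conj_by (word_prod W u)) (reflections v)"
  using assms
proof (induction u)
  case Nil
  then have "map (conj_by \<one>) (reflections v) = reflections v"
    using reflections_carrier[of v] by (intro map_idI) auto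
  then show ?case by simp
next
  case (Cons s u)
  then have "map (conj_by s \<circ> conj_by (word_prod W u)) (reflections v) =
      map (conj_by (s \<otimes> word_prod W u)) (reflections v)"
    using reflections_carrier[of v] by (intro map_cong) (auto simp: conj_by_mult subset_iff)
  then show ?case using Cons by simp
qed

lemma gen_pow_shift:
  assumes "s \<in> S" "t \<in> S"
  shows "s \<otimes> (t \<otimes> s) [^] (n::nat) = (s \<otimes> t) [^] n \<otimes> s"
proof (induction n)
  case (Suc n)
  have "s \<otimes> (t \<otimes> s) [^] Suc n = (s \<otimes> (t \<otimes> s) [^] n) \<otimes> (t \<otimes> s)"
    using assms by (simp add: m_assoc)
  also have "\<dots> = (s \<otimes> t) [^] Suc n \<otimes> s"
    using assms by (simp add: Suc m_assoc)
  finally show ?case .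
qed (use assms in auto)

text \<open>Inside a dihedral subgroup, periodicity and distinctness of the reflections become
  statements about the order of \<open>s \<otimes> t\<close>.\<close>

lemma reflections_alternating:
  assumes "s \<in> S" "t \<in> S"
  shows "reflections (alternating n s t) = map (\<lambda>i. (s \<otimes> t) [^] i \<otimes> s) [0..<n]"
  using assms
proof (induction n arbitrary: s t)
  case (Suc n)
  have *: "conj_by s ((t \<otimes> s) [^] i \<otimes> t) = (s \<otimes> t) [^] Suc i \<otimes> s" for i :: nat
  proof -
    have "conj_by s ((t \<otimes> s) [^] i \<otimes> t) = (s \<otimes> (t \<otimes> s) [^] i) \<otimes> t \<otimes> s"
      using Suc.prems by (simp add: conj_by_def m_assoc)
    then show ?thesis
      using Suc.prems by (simp add: gen_pow_shift m_assoc)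
  qed
  have "reflections (alternating (Suc n) s t) =
      s # map (\<lambda>i. (s \<otimes> t) [^] Suc i \<otimes> s) [0..<n]"
    using Suc by (simp add: * del: nat_pow_Suc)
  also have "\<dots> = map (\<lambda>i. (s \<otimes> t) [^] i \<otimes> s) (0 # map Suc [0..<n])"
    using Suc.prems by (simp add: comp_def)
  also have "0 # map Suc [0..<n] = [0..<Suc n]"
    by (simp add: map_Suc_upt upt_conv_Cons del: upt_Suc)
  finally show ?case .
qed simp

text \<open>At \<open>n = coxeter_mat W s t\<close> the power is trivial, so the two sides of a
  braid relation have the same product in W.\<close>

lemma word_prod_alternating:
  assumes "s \<in> S" "t \<in> S"
  shows "word_prod W (alternating n s t) \<otimes> inv (word_prod W (alternating n t s)) = (s \<otimes> t) [^] n"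
  using assms
proof (induction n arbitrary: s t)
  case (Suc n)
  have c: "word_prod W (alternating n s t) \<in> carrier W" "word_prod W (alternating n t s) \<in> carrier W"
    using alternating_lists[of s S t n] alternating_lists[of t S s n] Suc.prems by auto
  have "word_prod W (alternating (Suc n) s t) \<otimes> inv (word_prod W (alternating (Suc n) t s)) =
      s \<otimes> (word_prod W (alternating n t s) \<otimes> inv (word_prod W (alternating n s t))) \<otimes> t"
    using c Suc.prems by (simp add: m_assoc inv_mult_group)
  also have "\<dots> = (s \<otimes> t) [^] Suc n"
    using Suc.prems by (simp add: Suc.IH gen_pow_shift m_assoc)
  finally show ?case .
qed simp

lemma word_prod_alternating_double:
  assumes "s \<in> S" "t \<in> S"
  shows "word_prod W (alternating (2 * n) s t) = (s \<otimes> t) [^] n"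
proof (induction n)
  case (Suc n)
  have "(s \<otimes> t) [^] Suc n = (s \<otimes> t) \<otimes> (s \<otimes> t) [^] n"
    using assms by (intro nat_pow_Suc2) auto
  then show ?case using assms Suc by (simp add: m_assoc)
qed simp

text \<open>The set of all reflections met along a word changes when a subword such as ss is
  inserted; the parities do not.\<close>

definition odd_reflections :: "'a list \<Rightarrow> 'a set" where
  "odd_reflections ws = {t. odd (count_list (reflections ws) t)}"

lemma odd_reflections_subset: "odd_reflections ws \<subseteq> set (reflections ws)"
  unfolding odd_reflections_def by (metis (no_types, lifting) count_notin even_zero mem_Collect_eq subsetI)

lemma distinct_count_list: "distinct xs \<Longrightarrow> count_list xs x = (if x \<in> set xs then 1 else 0)"
  by (induction xs) auto

lemma odd_reflections_distinct:
  "distinct (reflections ws) \<Longrightarrow> odd_reflections ws = set (reflections ws)"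
  unfolding odd_reflections_def
  by (auto simp: distinct_count_list split: if_splits)

lemma count_list_map_conj_by:
  assumes "g \<in> carrier W" "t \<in> carrier W" "set xs \<subseteq> carrier W"
  shows "count_list (map (conj_by g) xs) t = count_list xs (conj_by (inv g) t)"
  using assms by (induction xs) auto

lemma odd_reflections_append:
  assumes "u \<in> lists S" "v \<in> lists S" "t \<in> carrier W"
  shows "t \<in> odd_reflections (u @ v) \<longleftrightarrow>
    (t \<in> odd_reflections u) \<noteq> (conj_by (inv (word_prod W u)) t \<in> odd_reflections v)"
  using assms reflections_carrier[OF assms(2)]
  by (simp add: odd_reflections_def reflections_append count_list_map_conj_by)

lemma odd_reflections_carrier: "ws \<in> lists S \<Longrightarrow> odd_reflections ws \<subseteq> carrier W"
  using odd_reflections_subset reflections_carrier by blast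

lemma coxeter_rel_trivial:
  assumes "(x, y) \<in> coxeter_rels W S"
  shows "x \<in> lists S" "y = []" "word_prod W x = \<one>" "odd_reflections x = {}"
proof -
  obtain s t where st: "s \<in> S" "t \<in> S" and y: "y = []"
    and x: "x = alternating (2 * ord (s \<otimes> t)) s t"
    using assms unfolding coxeter_rels_def coxeter_mat_def concat_replicate_alternating by blast
  show "y = []" by fact
  show "x \<in> lists S" using x st by (simp add: alternating_lists del: in_lists_conv_set)
  show "word_prod W x = \<one>" using x st by (simp add: word_prod_alternating_double)
  define k where "k = ord (s \<otimes> t)"
  \<comment> \<open>The reflections of the relator repeat with period k, so two full periods make
    every count even. For infinite order k is 0 and the relator is empty.\<close>
  have "[0..<2 * k] = [0..<k] @ map (\<lambda>i. i + k) [0..<k]"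
    by (simp add: mult_2 upt_add_eq_append[of 0 k k] map_add_upt)
  moreover have "(s \<otimes> t) [^] (i + k) = (s \<otimes> t) [^] i" for i
    using st by (simp add: k_def flip: nat_pow_mult)
  ultimately have "reflections x = map (\<lambda>i. (s \<otimes> t) [^] i \<otimes> s) [0..<k] @ map (\<lambda>i. (s \<otimes> t) [^] i \<otimes> s) [0..<k]"
    using x st by (simp add: reflections_alternating k_def[symmetric] comp_def)
  then show "odd_reflections x = {}"
    by (simp add: odd_reflections_def)
qed

lemma odd_reflections_cong:
  assumes "(u, v) \<in> word_cong S (coxeter_rels W S)"
  shows "odd_reflections u = odd_reflections v"
  using assms
proof (induction rule: word_cong.induct)
  case (rel x y u v)
  note xy = coxeter_rel_trivial[OF rel(1)]
  have "t \<in> odd_reflections (u @ x @ v) \<longleftrightarrow> t \<in> odd_reflections (u @ y @ v)" if "t \<in> carrier W" for t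
    using rel xy that by (simp add: odd_reflections_append)
  moreover have "odd_reflections (u @ x @ v) \<subseteq> carrier W" "odd_reflections (u @ y @ v) \<subseteq> carrier W"
    using rel by (simp_all add: odd_reflections_carrier)
  ultimately show ?case by blast
qed auto

text \<open>The chosen word is immaterial because equal products are congruent words by the
  presentation. The elements obtained are the left inversions, so inclusion compares prefixes, in
  agreement with the right weak order.\<close>

definition inversions :: "'a \<Rightarrow> 'a set" where
  "inversions w = odd_reflections (SOME ws. ws \<in> lists S \<and> word_prod W ws = w)"

lemma inversions_word_prod:
  assumes "ws \<in> lists S"
  shows "inversions (word_prod W ws) = odd_reflections ws"
proof -
  let ?v = "SOME v. v \<in> lists S \<and> word_prod W v = word_prod W ws"
  have "?v \<in> lists S \<and> word_prod W ?v = word_prod W ws"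
    by (rule someI[of _ ws]) (use assms in simp)
  then show ?thesis
    unfolding inversions_def using assms by (intro odd_reflections_cong) (simp flip: presentation)
qed

lemma inversions_carrier: "w \<in> carrier W \<Longrightarrow> inversions w \<subseteq> carrier W"
  using word_exists[of w] inversions_word_prod odd_reflections_carrier by fastforce

lemma finite_inversions [simp]: "w \<in> carrier W \<Longrightarrow> finite (inversions w)"
  using word_exists[of w] inversions_word_prod finite_subset[OF odd_reflections_subset]
  by fastforce

lemma inversions_mult_iff:
  assumes "x \<in> carrier W" "y \<in> carrier W" "t \<in> carrier W"
  shows "t \<in> inversions (x \<otimes> y) \<longleftrightarrow>
    (t \<in> inversions x) \<noteq> (conj_by (inv x) t \<in> inversions y)"
proof -
  obtain u v where "u \<in> lists S" "v \<in> lists S" "word_prod W u = x" "word_prod W v = y"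
    using assms word_exists by metis
  then show ?thesis
    using odd_reflections_append[of u v t] inversions_word_prod[of u] inversions_word_prod[of v]
      inversions_word_prod[of "u @ v"] assms by auto
qed

text \<open>Counts add along a concatenation, with the second factor's reflections conjugated by x.
  Lengths add exactly when the two sets are disjoint, and this governs every later comparison of x
  with a product starting in x.\<close>

lemma inversions_mult:
  assumes "x \<in> carrier W" "y \<in> carrier W"
  shows "inversions (x \<otimes> y) = sym_diff (inversions x) (conj_by x ` inversions y)"
proof -
  have "t \<in> inversions (x \<otimes> y) \<longleftrightarrow> t \<in> sym_diff (inversions x) (conj_by x ` inversions y)"
    if "t \<in> carrier W" for t
    using that assms inversions_mult_iff[of x y t] conj_by_mem_image[of x t "inversions y"]
      inversions_carrier by auto
  moreover have "inversions (x \<otimes> y) \<subseteq> carrier W"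
    "sym_diff (inversions x) (conj_by x ` inversions y) \<subseteq> carrier W"
    using assms inversions_carrier[of x] inversions_carrier[of y] inversions_carrier[of "x \<otimes> y"]
    by auto
  ultimately show ?thesis by blast
qed

lemma inversions_one [simp]: "inversions \<one> = {}"
  using inversions_word_prod[of "[]"] by (simp add: odd_reflections_def)

lemma inversions_gen [simp]: "s \<in> S \<Longrightarrow> inversions s = {s}"
  using inversions_word_prod[of "[s]"] by (auto simp: odd_reflections_def split: if_splits)

section \<open>Deletion of letters and the length function\<close>

abbreviation len :: "'a \<Rightarrow> nat" where
  "len w \<equiv> card (inversions w)"

text \<open>The alphabet A is carried along so that deletion stays inside a parabolic subgroup; the
  dihedral case below takes A to be two letters.\<close>

lemma reflection_deletion:
  assumes "t \<in> set (reflections ws)" "ws \<in> lists S" "set ws \<subseteq> A" "A \<subseteq> S"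
  shows "\<exists>vs \<in> lists A. Suc (length vs) = length ws \<and> word_prod W vs = t \<otimes> word_prod W ws"
  using assms
proof (induction ws arbitrary: t)
  case (Cons s ws)
  show ?case
  proof (cases "t = s")
    case True
    then show ?thesis using Cons.prems by (intro bexI[of _ ws]) auto
  next
    case False
    then obtain r where r: "r \<in> set (reflections ws)" "t = conj_by s r"
      using Cons.prems by auto
    then obtain vs where "vs \<in> lists A" "Suc (length vs) = length ws" "word_prod W vs = r \<otimes> word_prod W ws"
      using Cons by force
    moreover have "r \<in> carrier W" using r Cons.prems reflections_carrier by auto
    ultimately show ?thesis
      using Cons.prems r by (intro bexI[of _ "s # vs"]) (auto simp: conj_by_def m_assoc)
  qed
qed simp

lemma non_distinct_deletion:
  assumes "\<not> distinct (reflections ws)" "ws \<in> lists S" "set ws \<subseteq> A" "A \<subseteq> S"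
  shows "\<exists>vs \<in> lists A. length vs < length ws \<and> word_prod W vs = word_prod W ws"
  using assms
proof (induction ws)
  case (Cons s ws)
  have sub: "set (reflections ws) \<subseteq> carrier W" and s: "s \<in> S" "s \<in> A"
    using Cons.prems reflections_carrier by auto
  show ?case
  proof (cases "distinct (reflections ws)")
    case True
    \<comment> \<open>The tail is free of repetitions, so the repetition involves the head. Undoing
      the conjugation by s shows that s is a reflection of the tail; deleting it from the tail
      absorbs the head, and two letters disappear.\<close>
    then have "s \<in> conj_by s ` set (reflections ws)"
      using Cons.prems sub s inj_on_conj_by[of s] by (auto simp: distinct_map)
    then have "s \<in> set (reflections ws)"
      using conj_by_mem_image[OF _ _ sub, of s s] s by (metis conj_by_self gen_carrier gen_inv)
    then obtain vs where "vs \<in> lists A" "Suc (length vs) = length ws" "word_prod W vs = s \<otimes> word_prod W ws"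
      using reflection_deletion[of s ws A] Cons.prems by auto
    then show ?thesis by (intro bexI[of _ vs]) auto
  next
    case False
    then obtain vs where "vs \<in> lists A" "length vs < length ws" "word_prod W vs = word_prod W ws"
      using Cons by auto
    then show ?thesis using s by (intro bexI[of _ "s # vs"]) auto
  qed
qed simp

lemma coxeter_length_le:
  "ws \<in> lists S \<Longrightarrow> coxeter_length W S (word_prod W ws) \<le> length ws"
  unfolding coxeter_length_def by (rule Least_le) auto

lemma reduced_word_exists:
  assumes "w \<in> carrier W"
  shows "\<exists>ws. reduced_word W S ws w"
proof -
  have "\<exists>n. \<exists>ws \<in> lists S. length ws = n \<and> word_prod W ws = w"
    using word_exists[OF assms] by auto
  from LeastI_ex[OF this] show ?thesis
    unfolding reduced_word_def coxeter_length_def by metis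
qed

lemma reduced_word_distinct:
  assumes "reduced_word W S ws w"
  shows "distinct (reflections ws)"
proof (rule ccontr)
  assume "\<not> distinct (reflections ws)"
  then obtain vs where "vs \<in> lists S" "length vs < length ws" "word_prod W vs = w"
    using non_distinct_deletion[of ws S] assms unfolding reduced_word_def by auto
  then show False
    using coxeter_length_le[of vs] assms unfolding reduced_word_def by auto
qed

lemma inversions_distinct:
  assumes "ws \<in> lists S" "distinct (reflections ws)"
  shows "inversions (word_prod W ws) = set (reflections ws)" "len (word_prod W ws) = length ws"
  using assms by (simp_all add: inversions_word_prod odd_reflections_distinct distinct_card)

lemma coxeter_length_eq_len: "w \<in> carrier W \<Longrightarrow> coxeter_length W S w = len w"
  by (metis reduced_word_exists reduced_word_distinct inversions_distinct(2) reduced_word_def)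

lemma reduced_word_iff:
  "reduced_word W S ws w \<longleftrightarrow> ws \<in> lists S \<and> word_prod W ws = w \<and> length ws = len w"
  unfolding reduced_word_def by (metis coxeter_length_eq_len word_prod_closed)

lemma len_le: "ws \<in> lists S \<Longrightarrow> len (word_prod W ws) \<le> length ws"
  using coxeter_length_le[of ws] by (simp add: coxeter_length_eq_len)

lemma inversion_len_less:
  assumes "w \<in> carrier W" "t \<in> inversions w"
  shows "len (t \<otimes> w) < len w"
proof -
  obtain ws where ws: "reduced_word W S ws w" using reduced_word_exists assms by blast
  then have "t \<in> set (reflections ws)" "ws \<in> lists S"
    using inversions_distinct(1)[OF _ reduced_word_distinct[OF ws]] assms by (auto simp: reduced_word_def)
  then obtain vs where "vs \<in> lists S" "Suc (length vs) = length ws" "word_prod W vs = t \<otimes> w"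
    using reflection_deletion[of t ws S] ws by (auto simp: reduced_word_def)
  then show ?thesis using len_le[of vs] ws by (auto simp: reduced_word_iff)
qed

lemma inversions_empty_iff: "w \<in> carrier W \<Longrightarrow> inversions w = {} \<longleftrightarrow> w = \<one>"
  using reduced_word_exists[of w] by (auto simp: reduced_word_iff)

text \<open>The product rule applied to x times \<open>inv x \<otimes> y\<close> leaves no
  inversions for the second factor, and only the identity has none.\<close>

lemma inversions_inj:
  assumes "x \<in> carrier W" "y \<in> carrier W" "inversions x = inversions y"
  shows "x = y"
proof -
  have "inversions (x \<otimes> (inv x \<otimes> y)) = inversions x" using assms by simp
  then have "sym_diff (inversions x) (conj_by x ` inversions (inv x \<otimes> y)) = inversions x"
    using assms inversions_mult[of x "inv x \<otimes> y"] by simp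
  then have "inversions (inv x \<otimes> y) = {}" by blast
  then have "inv x \<otimes> y = \<one>" using assms by (simp add: inversions_empty_iff)
  then show ?thesis using assms by (metis inv_mult_cancel(2) r_one)
qed

end

section \<open>The weak order of a Coxeter group\<close>

lemma word_cong_lists: "(u, v) \<in> word_cong S R \<Longrightarrow> u \<in> lists S \<and> v \<in> lists S"
  by (induction rule: word_cong.induct) auto

lemma word_cong_context:
  assumes "(u, v) \<in> word_cong S R" "a \<in> lists S" "b \<in> lists S"
  shows "(a @ u @ b, a @ v @ b) \<in> word_cong S R"
  using assms
proof (induction rule: word_cong.induct)
  case (rel x y u v)
  then have "((a @ u) @ x @ (v @ b), (a @ u) @ y @ (v @ b)) \<in> word_cong S R"
    by (intro word_cong.rel) auto
  then show ?case by simp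
next
  case (refl u)
  then show ?case by (intro word_cong.refl) auto
next
  case (sym u v)
  then show ?case by (blast intro: word_cong.sym)
next
  case (trans u v w)
  then show ?case by (blast intro: word_cong.trans)
qed

lemma word_cong_append:
  assumes "(u, u') \<in> word_cong S R" "(v, v') \<in> word_cong S R"
  shows "(u @ v, u' @ v') \<in> word_cong S R"
proof (rule word_cong.trans)
  show "(u @ v, u' @ v) \<in> word_cong S R"
    using word_cong_context[OF assms(1), of "[]" v] word_cong_lists[OF assms(2)] by simp
  show "(u' @ v, u' @ v') \<in> word_cong S R"
    using word_cong_context[OF assms(2), of u' "[]"] word_cong_lists[OF assms(1)] by simp
qed

context coxeter_system
begin

text \<open>The inclusion says that nothing cancels in the symmetric difference, so x followed by y
  is a length-additive product.\<close>

lemma inversions_mult_disjoint: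
  assumes "x \<in> carrier W" "y \<in> carrier W" "inversions x \<subseteq> inversions (x \<otimes> y)"
  shows "inversions x \<inter> conj_by x ` inversions y = {}"
    and "inversions (x \<otimes> y) = inversions x \<union> conj_by x ` inversions y"
    and "len (x \<otimes> y) = len x + len y"
proof -
  note eq = inversions_mult[OF assms(1,2)]
  show d: "inversions x \<inter> conj_by x ` inversions y = {}"
    using assms(3) unfolding eq by blast
  show u: "inversions (x \<otimes> y) = inversions x \<union> conj_by x ` inversions y"
    using d unfolding eq by blast
  show "len (x \<otimes> y) = len x + len y"
    unfolding u using d assms inj_on_conj_by[OF assms(1) inversions_carrier[OF assms(2)]]
    by (simp add: card_Un_disjoint card_image)
qed

text \<open>Both sets are disjoint unions with the same first part \<open>inversions x\<close>, and
  conjugation is injective. Thus intervals above x can be studied as intervals above the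
  identity.\<close>

lemma inversions_subset_iff_translate:
  assumes "x \<in> carrier W" "a \<in> carrier W" "b \<in> carrier W"
    and "inversions x \<subseteq> inversions (x \<otimes> a)" "inversions x \<subseteq> inversions (x \<otimes> b)"
  shows "inversions (x \<otimes> a) \<subseteq> inversions (x \<otimes> b) \<longleftrightarrow> inversions a \<subseteq> inversions b"
proof -
  note A = inversions_mult_disjoint[OF assms(1,2,4)]
  note B = inversions_mult_disjoint[OF assms(1,3,5)]
  have "inversions (x \<otimes> a) \<subseteq> inversions (x \<otimes> b) \<longleftrightarrow> conj_by x ` inversions a \<subseteq> conj_by x ` inversions b"
    unfolding A(2) B(2) using A(1) B(1) by blast
  also have "\<dots> \<longleftrightarrow> inversions a \<subseteq> inversions b"
    using inj_on_conj_by[OF assms(1), of "inversions a \<union> inversions b"] inversions_carrier assms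
    by (subst image_subset_iff) (auto simp: inj_on_def, blast)
  finally show ?thesis .
qed

lemma inversions_prefix_translate:
  assumes "x \<in> carrier W" "a \<in> carrier W" "b \<in> carrier W"
    and "inversions x \<subseteq> inversions (x \<otimes> b)" "inversions a \<subseteq> inversions b"
  shows "inversions x \<subseteq> inversions (x \<otimes> a)" "inversions (x \<otimes> a) \<subseteq> inversions (x \<otimes> b)"
proof -
  note B = inversions_mult_disjoint[OF assms(1,3,4)]
  have "inversions x \<inter> conj_by x ` inversions a = {}" using B(1) assms(5) by blast
  then show 1: "inversions x \<subseteq> inversions (x \<otimes> a)"
    using inversions_mult[OF assms(1,2)] by blast
  show "inversions (x \<otimes> a) \<subseteq> inversions (x \<otimes> b)"
    using inversions_subset_iff_translate[OF assms(1-3) 1 assms(4)] assms(5) by blast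
qed

lemma gen_mem_inversions_mult:
  assumes "s \<in> S" "w \<in> carrier W"
  shows "s \<in> inversions (s \<otimes> w) \<longleftrightarrow> s \<notin> inversions w"
  using inversions_mult_iff[of s w s] assms conj_by_self[of s] by simp

lemma len_gen_mult:
  assumes "s \<in> S" "w \<in> carrier W" "s \<notin> inversions w"
  shows "len (s \<otimes> w) = Suc (len w)"
  using inversions_mult_disjoint(3)[of s w] gen_mem_inversions_mult[of s w] assms by simp

lemma len_gen_mult_less:
  assumes "s \<in> S" "w \<in> carrier W" "s \<in> inversions w"
  shows "Suc (len (s \<otimes> w)) = len w" "s \<notin> inversions (s \<otimes> w)"
proof -
  show *: "s \<notin> inversions (s \<otimes> w)" using gen_mem_inversions_mult assms by blast
  show "Suc (len (s \<otimes> w)) = len w"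
    using len_gen_mult[of s "s \<otimes> w"] * assms by simp
qed

lemma reduced_word_append:
  assumes "reduced_word W S u x" "reduced_word W S v y" "inversions x \<subseteq> inversions (x \<otimes> y)"
  shows "reduced_word W S (u @ v) (x \<otimes> y)"
proof -
  have "x \<in> carrier W" "y \<in> carrier W"
    using assms word_prod_closed unfolding reduced_word_def by blast+
  then show ?thesis
    using assms inversions_mult_disjoint(3)[of x y] by (auto simp: reduced_word_iff)
qed

lemma reduced_word_carrier: "reduced_word W S u x \<Longrightarrow> x \<in> carrier W"
  using word_prod_closed unfolding reduced_word_def by blast

lemma reduced_word_lists: "reduced_word W S u x \<Longrightarrow> u \<in> lists S"
  unfolding reduced_word_def by blast

lemma reduced_word_Cons:
  assumes "reduced_word W S u x" "s \<in> S" "s \<notin> inversions x"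
  shows "reduced_word W S (s # u) (s \<otimes> x)"
  using assms len_gen_mult[OF assms(2) reduced_word_carrier[OF assms(1)] assms(3)]
  by (auto simp: reduced_word_iff)

lemma reduced_word_ConsD:
  assumes "reduced_word W S (s # u) x"
  shows "s \<in> S" "s \<in> inversions x" "reduced_word W S u (s \<otimes> x)"
proof -
  have u: "u \<in> lists S" "s \<in> S" "word_prod W u \<in> carrier W" and x: "x = s \<otimes> word_prod W u"
    and l: "Suc (length u) = len x"
    using assms by (auto simp: reduced_word_iff)
  have le: "len (word_prod W u) \<le> length u" using len_le u by blast
  have sx: "s \<otimes> x = word_prod W u" using u x by simp
  show "s \<in> S" by fact
  show s: "s \<in> inversions x"
  proof (rule ccontr)
    assume "s \<notin> inversions x"
    then have "len (s \<otimes> x) = Suc (len x)"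
      using len_gen_mult[of s x] u x by simp
    then show False using le l sx by simp
  qed
  have "Suc (len (s \<otimes> x)) = len x" using len_gen_mult_less(1)[of s x] u x s by simp
  then show "reduced_word W S u (s \<otimes> x)"
    using u l sx by (simp add: reduced_word_iff)
qed

lemma first_letter_exists:
  assumes "w \<in> carrier W" "w \<noteq> \<one>"
  shows "\<exists>s \<in> S. s \<in> inversions w"
proof -
  obtain ws where "reduced_word W S ws w" using reduced_word_exists assms by blast
  then show ?thesis
    using assms reduced_word_ConsD by (cases ws) (auto simp: reduced_word_def)
qed

lemma reduced_word_one: "reduced_word W S u \<one> \<longleftrightarrow> u = []"
  by (auto simp: reduced_word_iff)

lemma reflections_conjugate_gen:
  assumes "ws \<in> lists S" "t \<in> set (reflections ws)"
  shows "\<exists>x \<in> carrier W. \<exists>s \<in> S. t = conj_by x s"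
  using assms
proof (induction ws arbitrary: t)
  case (Cons a ws)
  then show ?case
  proof (cases "t = a")
    case True
    then have "t = conj_by \<one> a" "a \<in> S" using Cons by auto
    then show ?thesis using one_closed by blast
  next
    case False
    then obtain r where "r \<in> set (reflections ws)" "t = conj_by a r" using Cons.prems by auto
    moreover from this obtain x s where "x \<in> carrier W" "s \<in> S" "r = conj_by x s"
      using Cons.IH by blast
    ultimately have "t = conj_by (a \<otimes> x) s" "a \<otimes> x \<in> carrier W" "s \<in> S"
      using Cons by (auto simp: conj_by_mult)
    then show ?thesis by blast
  qed
qed simp

lemma len_less_reflection_mult:
  assumes "x \<in> carrier W" "s \<in> S" "t = conj_by x s" "w \<in> carrier W" "t \<notin> inversions w"
  shows "len w < len (t \<otimes> w)"
proof -
  have t: "t \<in> carrier W" using assms by simp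
  have tt: "t \<otimes> (t \<otimes> w) = w" and tx: "t \<otimes> x = x \<otimes> s"
    and ct: "conj_by (inv t) t = t" and cx: "conj_by (inv x) t = s"
    using assms t by (simp_all add: conj_by_def m_assoc)
  \<comment> \<open>Test membership of t in the inversion set of
    \<open>t \<otimes> x = x \<otimes> s\<close> through both factorisations: the unknown membership
    in \<open>inversions x\<close> cancels.\<close>
  have "t \<in> inversions t"
    using inversions_mult_iff[of t x t] inversions_mult_iff[of x s t] t tx ct cx assms by auto
  then have "t \<in> inversions (t \<otimes> w)"
    using inversions_mult_iff[of t w t] t ct assms by auto
  then show ?thesis
    using inversion_len_less[of "t \<otimes> w" t] tt t assms by simp
qed

section \<open>Dihedral words\<close>

lemma coxeter_mat_sym:
  assumes "s \<in> S" "t \<in> S"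
  shows "coxeter_mat W t s = coxeter_mat W s t"
proof -
  have "t \<otimes> s = inv (s \<otimes> t)" using assms by (simp add: inv_mult_group)
  then show ?thesis using assms ord_inv[of "s \<otimes> t"] by (simp add: coxeter_mat_def)
qed

lemma alternating_prod_sym:
  assumes "s \<in> S" "t \<in> S"
  shows "word_prod W (alternating (coxeter_mat W s t) s t) =
    word_prod W (alternating (coxeter_mat W s t) t s)"
proof -
  let ?k = "coxeter_mat W s t"
  let ?x = "word_prod W (alternating ?k s t)" and ?y = "word_prod W (alternating ?k t s)"
  have c: "?x \<in> carrier W" "?y \<in> carrier W"
    using alternating_lists[of s S t] alternating_lists[of t S s] assms word_prod_closed by blast+
  have "?x \<otimes> inv ?y = \<one>"
    using word_prod_alternating[OF assms, of ?k] assms by (simp add: coxeter_mat_def)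
  then show ?thesis using c by (metis inv_closed inv_equality inv_inv)
qed

lemma distinct_reflections_alternating:
  assumes "s \<in> S" "t \<in> S"
  shows "distinct (reflections (alternating (coxeter_mat W s t) s t))"
proof -
  let ?k = "coxeter_mat W s t"
  have "inj_on (\<lambda>i. (s \<otimes> t) [^] i \<otimes> s) {0..<?k}"
  proof (rule inj_onI)
    fix i j assume ij: "i \<in> {0..<?k}" "j \<in> {0..<?k}"
      and "(s \<otimes> t) [^] i \<otimes> s = (s \<otimes> t) [^] j \<otimes> s"
    then have "(s \<otimes> t) [^] i = (s \<otimes> t) [^] j" using assms by simp
    moreover have "i \<in> {0..ord (s \<otimes> t) - 1}" "j \<in> {0..ord (s \<otimes> t) - 1}"
      using ij by (auto simp: coxeter_mat_def)
    ultimately show "i = j" using ord_inj[of "s \<otimes> t"] assms by (auto dest: inj_onD)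
  qed
  then show ?thesis using assms by (simp add: reflections_alternating distinct_map)
qed

lemma reduced_word_alternating:
  assumes "s \<in> S" "t \<in> S"
  shows "reduced_word W S (alternating (coxeter_mat W s t) s t)
    (word_prod W (alternating (coxeter_mat W s t) s t))"
  using inversions_distinct(2)[OF alternating_lists distinct_reflections_alternating] assms
  by (simp add: reduced_word_iff alternating_lists del: in_lists_conv_set)

text \<open>Two equal adjacent letters would contribute the same reflection twice.\<close>

lemma distinct_reflections_imp_alternating:
  assumes "ws \<in> lists {s, t}" "distinct (reflections ws)" "s \<in> S" "t \<in> S"
  shows "ws = alternating (length ws) s t \<or> ws = alternating (length ws) t s"
  using assms
proof (induction ws)
  case (Cons a ws)
  have ws: "set (reflections ws) \<subseteq> carrier W"
    using Cons by (intro reflections_carrier) auto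
  have a: "a \<in> S" using Cons by auto
  have "a \<notin> set (reflections ws)"
  proof
    assume "a \<in> set (reflections ws)"
    then have "conj_by a a \<in> set (map (conj_by a) (reflections ws))" by (simp only: set_map imageI)
    then show False using Cons.prems a by simp
  qed
  then have *: "ws = [] \<or> hd ws \<noteq> a" by (cases ws) auto
  have "ws = alternating (length ws) s t \<or> ws = alternating (length ws) t s"
    using Cons by (auto simp: distinct_map)
  then show ?case
    using * Cons by (cases "length ws") auto
qed simp

end

section \<open>Finite Coxeter systems: rank two and the longest element\<close>

locale finite_coxeter_system = coxeter_system +
  assumes finite_carrier [simp]: "finite (carrier W)"
begin

text \<open>Finiteness excludes the value 0, which encodes infinite order, so both sides of each
  braid relation have a first letter.\<close>

lemma coxeter_mat_pos: "s \<in> S \<Longrightarrow> t \<in> S \<Longrightarrow> 0 < coxeter_mat W s t"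
  using ord_ge_1[of "s \<otimes> t"] by (simp add: coxeter_mat_def)

text \<open>Split off the part of \<open>z\<close> in the dihedral subgroup generated by \<open>s\<close> and \<open>t\<close>: the minimal
  representative of the coset has no inversions in that subgroup.\<close>

lemma rank_two_join:
  assumes st: "s \<in> S" "t \<in> S" and z: "z \<in> carrier W" "s \<in> inversions z" "t \<in> inversions z"
    and "s \<noteq> t"
  shows "inversions (word_prod W (alternating (coxeter_mat W s t) s t)) \<subseteq> inversions z"
proof -
  let ?k = "coxeter_mat W s t"
  define D where "D = word_prod W ` lists {s, t}"
  have sub: "lists {s, t} \<subseteq> lists S" using st by (intro lists_mono) auto
  have Dc: "D \<subseteq> carrier W" unfolding D_def using sub word_prod_closed by blast
  have Dm: "x \<otimes> y \<in> D" if xy: "x \<in> D" "y \<in> D" for x y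
  proof -
    obtain u v where "u \<in> lists {s, t}" "v \<in> lists {s, t}" "x = word_prod W u" "y = word_prod W v"
      using xy unfolding D_def by blast
    then show ?thesis
      unfolding D_def using sub by (intro image_eqI[of _ _ "u @ v"]) (auto simp: subset_iff)
  qed
  have Di: "inv x \<in> D" if x: "x \<in> D" for x
  proof -
    obtain u where u: "u \<in> lists {s, t}" "x = word_prod W u" using x unfolding D_def by blast
    then have "inv x = word_prod W (rev u)" using subsetD[OF sub u(1)] word_prod_rev by simp
    then show ?thesis unfolding D_def using u by (intro image_eqI[of _ _ "rev u"]) auto
  qed
  have Dg: "s \<in> D" "t \<in> D" "\<one> \<in> D"
    unfolding D_def using st image_eqI[of s "word_prod W" "[s]"] image_eqI[of t "word_prod W" "[t]"]
      image_eqI[of \<one> "word_prod W" "[]"]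
    by simp_all
  have Dr: "set (reflections ws) \<subseteq> D" if "ws \<in> lists {s, t}" for ws
    using that
  proof (induction ws)
    case (Cons a ws)
    then have "a \<in> D" using Dg by auto
    then show ?case using Cons Dm Di by (auto simp: conj_by_def subset_iff)
  qed simp
  obtain d where d: "d \<in> D" and dmin: "\<And>e. e \<in> D \<Longrightarrow> len (d \<otimes> z) \<le> len (e \<otimes> z)"
    using ex_has_least_nat[of "\<lambda>e. e \<in> D" \<one> "\<lambda>e. len (e \<otimes> z)"] Dg by blast
  define v where "v = d \<otimes> z"
  define x where "x = inv d"
  have c: "d \<in> carrier W" "x \<in> carrier W" "v \<in> carrier W" "x \<in> D"
    using d Dc Di z by (auto simp: x_def v_def)
  have zx: "z = x \<otimes> v" using c z by (simp add: x_def v_def)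
  \<comment> \<open>An inversion of v inside D would give a shorter element of the same coset of D,
    against the choice of d.\<close>
  have vD: "r \<notin> inversions v" if "r \<in> D" for r
  proof
    assume "r \<in> inversions v"
    then have "len (r \<otimes> v) < len v" using inversion_len_less c by blast
    moreover have "r \<otimes> v = (r \<otimes> d) \<otimes> z" using that c z Dc by (auto simp: v_def m_assoc)
    ultimately show False using dmin[of "r \<otimes> d"] Dm[OF that d] by (simp add: v_def)
  qed
  \<comment> \<open>Since v contributes nothing in D, the product rule identifies the inversions of
    z in D with those of x.\<close>
  have zxD: "r \<in> inversions z \<longleftrightarrow> r \<in> inversions x" if r: "r \<in> D" for r
  proof -
    have "conj_by (inv x) r \<in> D"
      unfolding conj_by_def by (intro Dm Di r c(4))
    moreover have "r \<in> carrier W" using r Dc by blast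
    ultimately show ?thesis
      using inversions_mult_iff[of x v r] c(2,3) vD unfolding zx by blast
  qed
  \<comment> \<open>The word is shortest among words in s and t only. Deletion within this alphabet
    still makes its reflections distinct, hence makes the word alternating.\<close>
  obtain ws where ws: "ws \<in> lists {s, t}" "word_prod W ws = x"
    and wsmin: "\<And>u. u \<in> lists {s, t} \<Longrightarrow> word_prod W u = x \<Longrightarrow> length ws \<le> length u"
  proof -
    obtain w0 where "w0 \<in> lists {s, t} \<and> word_prod W w0 = x" using c unfolding D_def by blast
    from ex_has_least_nat[of "\<lambda>u. u \<in> lists {s, t} \<and> word_prod W u = x", OF this, of length]
    show ?thesis using that by blast
  qed
  have wsS: "ws \<in> lists S" using ws sub by blast
  have dist: "distinct (reflections ws)"
  proof (rule ccontr)
    assume "\<not> distinct (reflections ws)"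
    moreover have "set ws \<subseteq> {s, t}" "{s, t} \<subseteq> S" using ws(1) st by auto
    ultimately obtain vs where "vs \<in> lists {s, t}" "length vs < length ws" "word_prod W vs = x"
      using non_distinct_deletion[OF _ wsS] ws(2) by metis
    then show False using wsmin by fastforce
  qed
  have Ix: "inversions x = set (reflections ws)"
    using inversions_distinct(1)[OF wsS dist] ws by simp
  obtain a b where ab: "a \<in> {s, t}" "b \<in> {s, t}" "a \<noteq> b" and wsa: "ws = alternating (length ws) a b"
    using distinct_reflections_imp_alternating[OF ws(1) dist st] \<open>s \<noteq> t\<close> by blast
  then have abS: "a \<in> S" "b \<in> S" using st by auto
  define n where "n = length ws"
  have k: "?k = ord (a \<otimes> b)" "word_prod W (alternating ?k a b) = word_prod W (alternating ?k s t)"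
    using ab alternating_prod_sym[OF st] coxeter_mat_sym[OF st] by (auto simp: coxeter_mat_def)
  have refl: "reflections ws = map (\<lambda>i. (a \<otimes> b) [^] i \<otimes> a) [0..<n]"
    using reflections_alternating[OF abS] wsa n_def by metis
  \<comment> \<open>The reflections have period \<open>?k\<close>, so a longer alternating word
    would repeat its first one.\<close>
  have "n \<le> ?k"
  proof (rule ccontr)
    assume "\<not> n \<le> ?k"
    then have "0 < n" "?k < n" by auto
    then have "reflections ws ! 0 = reflections ws ! ?k"
      unfolding refl using abS k by simp
    then show False
      using dist \<open>0 < n\<close> \<open>?k < n\<close> coxeter_mat_pos[OF st] n_def
      by (simp add: nth_eq_iff_index_eq)
  qed
  \<comment> \<open>The second letter b is also an inversion of x, so it equals some power of
    \<open>a \<otimes> b\<close> times a. Multiplying by b turns this into a trivial power with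
    exponent i + 1, a multiple of \<open>?k\<close>, while i is below n.\<close>
  moreover have "?k \<le> n"
  proof -
    have "b \<in> inversions x" using zxD Dg ab z by auto
    then obtain i where i: "i < n" "b = (a \<otimes> b) [^] i \<otimes> a"
      unfolding Ix refl by auto
    have "b \<otimes> b = (a \<otimes> b) [^] Suc i"
      using i(2) abS by (metis gen_carrier m_assoc m_closed nat_pow_Suc nat_pow_closed)
    then have "?k dvd Suc i" using pow_eq_id[of "a \<otimes> b" "Suc i"] abS k by simp
    then show ?thesis using i by (meson Suc_leI dvd_imp_le le_trans zero_less_Suc)
  qed
  ultimately have "x = word_prod W (alternating ?k s t)"
    using ws wsa n_def k by (metis order_antisym)
  moreover have "inversions x \<subseteq> D" using Ix Dr ws by simp
  ultimately show ?thesis using zxD by blast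
qed

lemma gen_join_exists:
  assumes "s \<in> S" "t \<in> S"
  shows "\<exists>b \<in> carrier W. s \<in> inversions b \<and> t \<in> inversions b \<and>
    (\<forall>z \<in> carrier W. s \<in> inversions z \<longrightarrow> t \<in> inversions z \<longrightarrow> inversions b \<subseteq> inversions z)"
proof (cases "s = t")
  case True
  then show ?thesis using assms by (intro bexI[of _ s]) auto
next
  case False
  let ?k = "coxeter_mat W s t"
  obtain n where n: "?k = Suc n" using coxeter_mat_pos[OF assms] gr0_implies_Suc by blast
  have "s \<in> inversions (word_prod W (alternating ?k s t))"
    using reduced_word_ConsD(2) reduced_word_alternating[OF assms] n by (metis alternating.simps(2))
  moreover have "t \<in> inversions (word_prod W (alternating ?k t s))"
    using reduced_word_ConsD(2) reduced_word_alternating[OF assms(2,1)] n coxeter_mat_sym[OF assms]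
    by (metis alternating.simps(2))
  ultimately show ?thesis
    using rank_two_join[OF assms] False alternating_prod_sym[OF assms]
      reduced_word_carrier[OF reduced_word_alternating[OF assms]]
    by (intro bexI[of _ "word_prod W (alternating ?k s t)"]) auto
qed

text \<open>A reflection missing from the inversions of an element of maximal length would lengthen
  it by left multiplication. Such an element therefore has every reflection as an inversion, which
  also makes it unique.\<close>

lemma longest_element:
  shows "longest_element W S \<in> carrier W"
    and "\<And>w. w \<in> carrier W \<Longrightarrow> inversions w \<subseteq> inversions (longest_element W S)"
proof -
  define P where "P w \<longleftrightarrow> w \<in> carrier W \<and>
    (\<forall>v \<in> carrier W. coxeter_length W S v \<le> coxeter_length W S w)" for w
  have top: "inversions w \<subseteq> inversions x" if x: "P x" and w: "w \<in> carrier W" for x w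
  proof
    fix t assume t: "t \<in> inversions w"
    obtain ws where "ws \<in> lists S" "word_prod W ws = w" using word_exists w by blast
    then have "t \<in> set (reflections ws)" "ws \<in> lists S"
      using t odd_reflections_subset inversions_word_prod by blast+
    then obtain y s where ys: "y \<in> carrier W" "s \<in> S" "t = conj_by y s"
      using reflections_conjugate_gen by blast
    show "t \<in> inversions x"
    proof (rule ccontr)
      assume "t \<notin> inversions x"
      then have "len x < len (t \<otimes> x)" using len_less_reflection_mult[OF ys] x by (simp add: P_def)
      moreover have "coxeter_length W S (t \<otimes> x) \<le> coxeter_length W S x"
        using x ys unfolding P_def by simp
      then have "len (t \<otimes> x) \<le> len x"
        using x ys unfolding P_def by (simp add: coxeter_length_eq_len)
      ultimately show False by simp
    qed
  qed
  have fin: "finite (coxeter_length W S ` carrier W)" "coxeter_length W S ` carrier W \<noteq> {}"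
    using one_closed by auto
  obtain x where "x \<in> carrier W" "coxeter_length W S x = Max (coxeter_length W S ` carrier W)"
    using Max_in[OF fin] by auto
  then have x: "P x" unfolding P_def using fin by simp
  have "longest_element W S = (THE w. P w)" unfolding longest_element_def P_def ..
  also have "(THE w. P w) = x"
  proof (rule the_equality)
    fix y assume y: "P y"
    then have "inversions y = inversions x" using top x by (auto simp: P_def)
    then show "y = x" using inversions_inj x y by (simp add: P_def)
  qed (fact x)
  finally have "longest_element W S = x" .
  then show "longest_element W S \<in> carrier W"
    "\<And>w. w \<in> carrier W \<Longrightarrow> inversions w \<subseteq> inversions (longest_element W S)"
    using x top P_def by auto
qed

section \<open>Joins in W\<close>

definition is_join :: "'a \<Rightarrow> 'a \<Rightarrow> 'a \<Rightarrow> bool" where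
  "is_join x y j \<longleftrightarrow> j \<in> carrier W \<and> inversions x \<subseteq> inversions j \<and> inversions y \<subseteq> inversions j \<and>
    (\<forall>z \<in> carrier W. inversions x \<subseteq> inversions z \<longrightarrow> inversions y \<subseteq> inversions z \<longrightarrow>
      inversions j \<subseteq> inversions z)"

text \<open>The induction climbs along a common lower bound x. Take covers x s below u and x t below
  v, with join x b. Then u and x b lie above x s, giving a join q; then q and v lie above x t,
  giving the join of u and v. Both calls use a longer lower bound.\<close>

lemma is_join_exists_above:
  assumes "x \<in> carrier W" "u \<in> carrier W" "v \<in> carrier W"
    and "inversions x \<subseteq> inversions u" "inversions x \<subseteq> inversions v"
  shows "\<exists>j. is_join u v j"
  using assms
proof (induction "card (carrier W) - len x" arbitrary: x u v rule: less_induct)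
  case less
  let ?top = "longest_element W S"
  note c = less.prems(1-3)
  have split: "y = x \<otimes> (inv x \<otimes> y)" if "y \<in> carrier W" for y using that c by simp
  have quot: "inversions a \<subseteq> inversions (inv x \<otimes> y)"
    if "a \<in> carrier W" "y \<in> carrier W" "inversions x \<subseteq> inversions (x \<otimes> a)" "inversions (x \<otimes> a) \<subseteq> inversions y"
    for a y
    using inversions_subset_iff_translate[of x a "inv x \<otimes> y"] that c split[of y] by auto
  have lift: "inversions x \<subseteq> inversions (x \<otimes> a)" "inversions (x \<otimes> a) \<subseteq> inversions y"
    if "a \<in> carrier W" "y \<in> carrier W" "inversions x \<subseteq> inversions y" "inversions a \<subseteq> inversions (inv x \<otimes> y)"
    for a y
    using inversions_prefix_translate[of x a "inv x \<otimes> y"] that c split[of y] by auto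
  show ?case
  proof (cases "u = x \<or> v = x")
    case True
    then show ?thesis using less.prems unfolding is_join_def by blast
  next
    case False
    have ne: "inv x \<otimes> u \<noteq> \<one>" "inv x \<otimes> v \<noteq> \<one>"
      using False c split[of u] split[of v] by (metis r_one)+
    obtain s where s: "s \<in> S" "s \<in> inversions (inv x \<otimes> u)"
      using first_letter_exists[OF _ ne(1)] c by auto
    obtain t where t: "t \<in> S" "t \<in> inversions (inv x \<otimes> v)"
      using first_letter_exists[OF _ ne(2)] c by auto
    obtain b where b: "b \<in> carrier W" "s \<in> inversions b" "t \<in> inversions b"
      and bmin: "\<And>z. z \<in> carrier W \<Longrightarrow> s \<in> inversions z \<Longrightarrow> t \<in> inversions z \<Longrightarrow> inversions b \<subseteq> inversions z"
      using gen_join_exists[OF s(1) t(1)] by blast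
    have topc: "?top \<in> carrier W" "\<And>y. y \<in> carrier W \<Longrightarrow> inversions y \<subseteq> inversions ?top"
      using longest_element by auto
    have xs: "inversions x \<subseteq> inversions (x \<otimes> s)" "inversions (x \<otimes> s) \<subseteq> inversions u"
      using lift[of s u] s c less.prems by auto
    have xt: "inversions x \<subseteq> inversions (x \<otimes> t)" "inversions (x \<otimes> t) \<subseteq> inversions v"
      using lift[of t v] t c less.prems by auto
    \<comment> \<open>The upper bound \<open>?top\<close> is what guarantees that x b is
      length-additive: s and t both begin the remainder of \<open>?top\<close> after x, hence so
      does b.\<close>
    have "s \<in> inversions (inv x \<otimes> ?top)" "t \<in> inversions (inv x \<otimes> ?top)"
      using quot[of s ?top] quot[of t ?top] xs xt s t topc c by auto
    then have "inversions b \<subseteq> inversions (inv x \<otimes> ?top)" using bmin topc c by simp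
    then have p: "inversions x \<subseteq> inversions (x \<otimes> b)" using lift(1)[of b ?top] b topc c by simp
    have psp: "inversions (x \<otimes> s) \<subseteq> inversions (x \<otimes> b)"
      using inversions_subset_iff_translate[of x s b] xs p b s c by simp
    have ptp: "inversions (x \<otimes> t) \<subseteq> inversions (x \<otimes> b)"
      using inversions_subset_iff_translate[of x t b] xt p b t c by simp
    have pmin: "inversions (x \<otimes> b) \<subseteq> inversions z"
      if z: "z \<in> carrier W" "inversions (x \<otimes> s) \<subseteq> inversions z" "inversions (x \<otimes> t) \<subseteq> inversions z" for z
    proof -
      have "s \<in> inversions (inv x \<otimes> z)" "t \<in> inversions (inv x \<otimes> z)"
        using quot[of s z] quot[of t z] z xs xt s t by auto
      then show ?thesis using lift(2)[of b z] bmin[of "inv x \<otimes> z"] z c b xs by auto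
    qed
    \<comment> \<open>Inversions are elements of W, so the order of W bounds all lengths and the
      truncated difference really decreases.\<close>
    have dec: "card (carrier W) - len (x \<otimes> a) < card (carrier W) - len x"
      if a: "a \<in> S" "inversions x \<subseteq> inversions (x \<otimes> a)" for a
    proof -
      have "len (x \<otimes> a) = Suc (len x)" using inversions_mult_disjoint(3)[of x a] a c by simp
      moreover have "len (x \<otimes> a) \<le> card (carrier W)"
        using inversions_carrier[of "x \<otimes> a"] a c by (intro card_mono) auto
      ultimately show ?thesis by simp
    qed
    obtain q where q: "is_join u (x \<otimes> b) q"
      using less.hyps[OF dec[OF s(1) xs(1)], of u "x \<otimes> b"] xs psp s b c by auto
    have qc: "q \<in> carrier W" "inversions (x \<otimes> t) \<subseteq> inversions q"
      using q ptp unfolding is_join_def by blast+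
    obtain r where r: "is_join q v r"
      using less.hyps[OF dec[OF t(1) xt(1)], of q v] qc xt t c by auto
    have "is_join u v r"
      unfolding is_join_def
    proof (intro conjI ballI impI)
      show "r \<in> carrier W" "inversions u \<subseteq> inversions r" "inversions v \<subseteq> inversions r"
        using q r unfolding is_join_def by blast+
      fix z assume z: "z \<in> carrier W" "inversions u \<subseteq> inversions z" "inversions v \<subseteq> inversions z"
      then have "inversions (x \<otimes> b) \<subseteq> inversions z" using pmin xs xt by blast
      then show "inversions r \<subseteq> inversions z" using q r z unfolding is_join_def by blast
    qed
    then show ?thesis by blast
  qed
qed

lemma is_join_exists: "u \<in> carrier W \<Longrightarrow> v \<in> carrier W \<Longrightarrow> \<exists>j. is_join u v j"
  using is_join_exists_above[of \<one> u v] by simp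

section \<open>Braid equivalence and Matsumoto's theorem\<close>

abbreviation braid_equiv :: "'a list \<Rightarrow> 'a list \<Rightarrow> bool" (infix \<open>\<approx>\<close> 50) where
  "u \<approx> v \<equiv> (u, v) \<in> word_cong S (braid_rels W S)"

lemma braid_move:
  assumes "s \<in> S" "t \<in> S" "s \<noteq> t"
  shows "alternating (coxeter_mat W s t) s t \<approx> alternating (coxeter_mat W s t) t s"
proof -
  have "(alternating (coxeter_mat W s t) s t, alternating (coxeter_mat W s t) t s) \<in> braid_rels W S"
    unfolding braid_rels_def using assms by blast
  from word_cong.rel[OF this, of S "[]" "[]"] show ?thesis
    using alternating_lists[OF assms(1,2)] alternating_lists[OF assms(2,1)] by simp
qed

lemma braid_equiv_Cons: "s \<in> S \<Longrightarrow> u \<approx> v \<Longrightarrow> s # u \<approx> s # v"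
  using word_cong_context[of u v S _ "[s]" "[]"] by simp

text \<open>If the first letters a and b differ, both are inversions of w, so w has reduced words
  starting with either side of the braid relation for a and b. Each given word shares its first
  letter with one of these and is compared with it by induction on the tails.\<close>

theorem matsumoto:
  assumes "reduced_word W S u w" "reduced_word W S v w"
  shows "u \<approx> v"
  using assms
proof (induction "length u" arbitrary: u v w rule: less_induct)
  case less
  have lv: "length v = length u" using less.prems by (simp add: reduced_word_def)
  show ?case
  proof (cases u)
    case Nil
    then show ?thesis using lv word_cong.refl[of "[]"] by simp
  next
    case (Cons a u')
    then obtain b v' where v: "v = b # v'" using lv by (cases v) auto
    note A = reduced_word_ConsD[OF less.prems(1)[unfolded Cons]]
    note B = reduced_word_ConsD[OF less.prems(2)[unfolded v]]
    have wc: "w \<in> carrier W" using less.prems reduced_word_carrier by blast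
    show ?thesis
    proof (cases "a = b")
      case True
      then show ?thesis
        using less.hyps[of u' "a \<otimes> w" v'] A B Cons v braid_equiv_Cons by simp
    next
      case False
      let ?k = "coxeter_mat W a b"
      let ?p = "word_prod W (alternating ?k a b)"
      have pc: "?p \<in> carrier W" using reduced_word_carrier[OF reduced_word_alternating[OF A(1) B(1)]] .
      have pw: "inversions ?p \<subseteq> inversions (?p \<otimes> (inv ?p \<otimes> w))"
        using rank_two_join[OF A(1) B(1) wc A(2) B(2) False] pc wc by simp
      obtain z where z: "reduced_word W S z (inv ?p \<otimes> w)"
        using reduced_word_exists[of "inv ?p \<otimes> w"] pc wc by auto
      have 1: "reduced_word W S (alternating ?k a b @ z) w"
        using reduced_word_append[OF reduced_word_alternating[OF A(1) B(1)] z pw] pc wc by simp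
      have "reduced_word W S (alternating ?k b a) ?p"
        using reduced_word_alternating[OF B(1) A(1)] alternating_prod_sym[OF A(1) B(1)]
          coxeter_mat_sym[OF A(1) B(1)] by simp
      from reduced_word_append[OF this z pw]
      have 2: "reduced_word W S (alternating ?k b a @ z) w" using pc wc by simp
      obtain n where n: "?k = Suc n" using coxeter_mat_pos[OF A(1) B(1)] gr0_implies_Suc by blast
      have "u' \<approx> alternating n b a @ z"
        using less.hyps[of u' "a \<otimes> w" "alternating n b a @ z"] A
          reduced_word_ConsD(3)[of a "alternating n b a @ z"] 1 n Cons by simp
      then have "u \<approx> alternating ?k a b @ z" using braid_equiv_Cons[OF A(1)] Cons n by simp
      moreover have "v' \<approx> alternating n a b @ z"
        using less.hyps[of v' "b \<otimes> w" "alternating n a b @ z"] B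
          reduced_word_ConsD(3)[of b "alternating n a b @ z"] 2 n v lv by simp
      then have "v \<approx> alternating ?k b a @ z" using braid_equiv_Cons[OF B(1)] v n by simp
      moreover have "alternating ?k a b @ z \<approx> alternating ?k b a @ z"
        using word_cong_append[OF braid_move[OF A(1) B(1) False] word_cong.refl[of z]]
          reduced_word_lists[OF z] by blast
      ultimately show ?thesis by (meson word_cong.sym word_cong.trans)
    qed
  qed
qed

section \<open>Divisibility in the Artin monoid\<close>

lemmas braid_trans [trans] = word_cong.trans[of _ _ S "braid_rels W S"]

lemma braid_refl: "u \<in> lists S \<Longrightarrow> u \<approx> u"
  by (rule word_cong.refl)

lemma braid_equiv_length: "u \<approx> v \<Longrightarrow> length u = length v"
  by (induction rule: word_cong.induct) (auto simp: braid_rels_def)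

text \<open>A word for the simple element attached to w; by Matsumoto's theorem its braid class does
  not depend on the choice.\<close>

definition red :: "'a \<Rightarrow> 'a list" where
  "red w = (SOME ws. reduced_word W S ws w)"

lemma reduced_word_red: "w \<in> carrier W \<Longrightarrow> reduced_word W S (red w) w"
  unfolding red_def using reduced_word_exists by (metis someI_ex)

lemma red_lists: "w \<in> carrier W \<Longrightarrow> red w \<in> lists S"
  using reduced_word_red reduced_word_lists by blast

lemma red_one [simp]: "red \<one> = []"
  using reduced_word_red[of \<one>] reduced_word_one by simp

lemma red_mult:
  assumes "x \<in> carrier W" "y \<in> carrier W" "inversions x \<subseteq> inversions (x \<otimes> y)"
  shows "red (x \<otimes> y) \<approx> red x @ red y"
  using assms by (intro matsumoto[of _ "x \<otimes> y"] reduced_word_append reduced_word_red) auto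

lemma red_prefix:
  assumes "x \<in> carrier W" "y \<in> carrier W" "inversions x \<subseteq> inversions y"
  shows "red y \<approx> red x @ red (inv x \<otimes> y)"
  using red_mult[of x "inv x \<otimes> y"] assms by simp

lemma red_gen_mult:
  assumes "s \<in> S" "x \<in> carrier W" "s \<notin> inversions x"
  shows "red (s \<otimes> x) \<approx> s # red x"
  using assms by (intro matsumoto[of _ "s \<otimes> x"] reduced_word_Cons reduced_word_red) auto

lemma red_inversion:
  assumes "s \<in> S" "x \<in> carrier W" "s \<in> inversions x"
  shows "red x \<approx> s # red (s \<otimes> x)"
  using red_gen_mult[of s "s \<otimes> x"] len_gen_mult_less(2)[OF assms] assms by simp

lemma inversions_subset_gen_translate:
  assumes "s \<in> S" "x \<in> carrier W" "y \<in> carrier W" "s \<in> inversions x" "s \<in> inversions y"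
  shows "inversions (s \<otimes> x) \<subseteq> inversions (s \<otimes> y) \<longleftrightarrow> inversions x \<subseteq> inversions y"
  using inversions_subset_iff_translate[of s "s \<otimes> x" "s \<otimes> y"] assms by simp

text \<open>Every element avoiding s as an inversion lies below \<open>s \<otimes> ?top\<close>,
  which avoids s itself. The bound passes to joins, so a letter stripped from both arguments can be
  put back in front of their join without losing reducedness.\<close>

lemma is_join_gen_notin:
  assumes "is_join x y j" "s \<in> S" "x \<in> carrier W" "y \<in> carrier W"
    and "s \<notin> inversions x" "s \<notin> inversions y"
  shows "s \<notin> inversions j"
proof -
  let ?top = "longest_element W S"
  note top = longest_element
  have bound: "inversions z \<subseteq> inversions (s \<otimes> ?top)" if z: "z \<in> carrier W" "s \<notin> inversions z" for z
  proof -
    have "s \<in> inversions (s \<otimes> z)" using gen_mem_inversions_mult assms(2) z by simp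
    moreover have "s \<in> inversions ?top" using top(2)[of s] assms(2) by simp
    ultimately show ?thesis
      using inversions_subset_gen_translate[of s "s \<otimes> z" ?top] top z assms(2) by simp
  qed
  have "s \<in> inversions ?top" using top(2)[of s] assms(2) by simp
  then have "s \<notin> inversions (s \<otimes> ?top)" using len_gen_mult_less(2) assms(2) top(1) by blast
  moreover have "inversions j \<subseteq> inversions (s \<otimes> ?top)"
    using assms bound top(1) unfolding is_join_def by (meson gen_carrier m_closed)
  ultimately show ?thesis by blast
qed

section \<open>Left divisibility of words\<close>

definition left_div :: "'a list \<Rightarrow> 'a list \<Rightarrow> bool" (infix \<open>\<preceq>\<close> 50) where
  "u \<preceq> v \<longleftrightarrow> (\<exists>z \<in> lists S. u @ z \<approx> v)"

lemma left_div_lists: "u \<preceq> v \<Longrightarrow> u \<in> lists S \<and> v \<in> lists S"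
  unfolding left_div_def using word_cong_lists by fastforce

lemma left_div_refl: "u \<in> lists S \<Longrightarrow> u \<preceq> u"
  unfolding left_div_def using braid_refl[of u] by (intro bexI[of _ "[]"]) auto

lemma left_div_Nil: "u \<in> lists S \<Longrightarrow> [] \<preceq> u"
  unfolding left_div_def using braid_refl[of u] by (intro bexI[of _ u]) auto

lemma left_div_append: "u \<in> lists S \<Longrightarrow> v \<in> lists S \<Longrightarrow> u \<preceq> u @ v"
  unfolding left_div_def using braid_refl[of "u @ v"] by (intro bexI[of _ v]) auto

lemma left_div_trans [trans]:
  assumes "u \<preceq> v" "v \<preceq> w"
  shows "u \<preceq> w"
proof -
  obtain y z where yz: "y \<in> lists S" "u @ y \<approx> v" "z \<in> lists S" "v @ z \<approx> w"
    using assms unfolding left_div_def by blast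
  then have "(u @ y) @ z \<approx> v @ z" by (intro word_cong_append braid_refl)
  from braid_trans[OF this yz(4)] have "u @ (y @ z) \<approx> w" by simp
  moreover have "y @ z \<in> lists S" using yz by simp
  ultimately show ?thesis unfolding left_div_def by blast
qed

lemma left_div_of_equiv:
  assumes "u \<approx> v"
  shows "u \<preceq> v"
  unfolding left_div_def using assms by (intro bexI[of _ "[]"]) auto

lemma left_div_equiv_trans [trans]:
  "u \<approx> v \<Longrightarrow> v \<preceq> w \<Longrightarrow> u \<preceq> w"
  "u \<preceq> v \<Longrightarrow> v \<approx> w \<Longrightarrow> u \<preceq> w"
  using left_div_of_equiv left_div_trans by blast+

lemma left_div_Cons: "s \<in> S \<Longrightarrow> u \<preceq> v \<Longrightarrow> s # u \<preceq> s # v"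
  unfolding left_div_def using braid_equiv_Cons by fastforce

lemma red_left_div:
  assumes "x \<in> carrier W" "y \<in> carrier W" "inversions x \<subseteq> inversions y"
  shows "red x \<preceq> red y"
  unfolding left_div_def
  using word_cong.sym[OF red_prefix[OF assms]] red_lists assms
  by (intro bexI[of _ "red (inv x \<otimes> y)"]) auto

text \<open>\<open>reduction n\<close> is Garside's reduction lemma for words of length \<open>n + 1\<close>.\<close>

definition common_head :: "'a \<Rightarrow> 'a list \<Rightarrow> 'a \<Rightarrow> 'a list \<Rightarrow> bool" where
  "common_head a X b Y \<longleftrightarrow> (\<exists>K \<in> carrier W. \<exists>R \<in> lists S. a \<in> inversions K \<and> b \<in> inversions K \<and>
    X \<approx> red (a \<otimes> K) @ R \<and> Y \<approx> red (b \<otimes> K) @ R)"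

definition reduction :: "nat \<Rightarrow> bool" where
  "reduction n \<longleftrightarrow> (\<forall>a X b Y. a # X \<approx> b # Y \<longrightarrow> length X = n \<longrightarrow> common_head a X b Y)"

lemma common_head_sym: "common_head a X b Y \<Longrightarrow> common_head b Y a X"
  unfolding common_head_def by blast

lemma common_head_same:
  assumes "a \<in> S" "X \<approx> Y"
  shows "common_head a X a Y"
  unfolding common_head_def
  using assms word_cong_lists[OF assms(2)] braid_refl[of Y]
  by (intro bexI[of _ a] bexI[of _ Y]) simp_all

lemma reduction_cancel:
  assumes "reduction (length X)" "a # X \<approx> a # Y"
  shows "X \<approx> Y"
proof -
  obtain K R where "X \<approx> red (a \<otimes> K) @ R" "Y \<approx> red (a \<otimes> K) @ R"
    using assms unfolding reduction_def common_head_def by blast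
  then show ?thesis using braid_trans word_cong.sym by blast
qed

text \<open>Since \<open>reduction k\<close> speaks of words of length k + 1, knowing it below n
  permits cancellation in words of length up to n.\<close>

lemma reduction_cancel_word:
  assumes "\<forall>k<n. reduction k" "u @ X \<approx> u @ Y" "length (u @ X) \<le> n"
  shows "X \<approx> Y"
  using assms
proof (induction u)
  case (Cons a u)
  then have "u @ X \<approx> u @ Y" using reduction_cancel[of "u @ X" a "u @ Y"] by simp
  then show ?case using Cons by simp
qed simp

text \<open>Write U as a X and as b Y, with a starting x and b starting y. Joining inside X produces
  a divisor q of U above x that also starts with b; joining inside Y then produces a divisor r above
  both q and y. Only the shorter words X and Y are used inductively.\<close>

lemma reduction_red_join:
  assumes "\<forall>k<n. reduction k" "length U \<le> n" "x \<in> carrier W" "y \<in> carrier W"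
    and "red x \<preceq> U" "red y \<preceq> U" "is_join x y j"
  shows "red j \<preceq> U"
  using assms
proof (induction "length U" arbitrary: U x y j rule: less_induct)
  case less
  note c = less.prems(3,4)
  have jc: "j \<in> carrier W" using less.prems(7) is_join_def by blast
  consider "x = \<one>" | "y = \<one>" | "x \<noteq> \<one>" "y \<noteq> \<one>" by blast
  then show ?case
  proof cases
    case 1
    then have "inversions j = inversions y" using less.prems c by (auto simp: is_join_def)
    then show ?thesis using inversions_inj jc c less.prems by metis
  next
    case 2
    then have "inversions j = inversions x" using less.prems c by (auto simp: is_join_def)
    then show ?thesis using inversions_inj jc c less.prems by metis
  next
    case 3
    obtain a where a: "a \<in> S" "a \<in> inversions x" using first_letter_exists c 3 by blast
    obtain b where b: "b \<in> S" "b \<in> inversions y" using first_letter_exists c 3 by blast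
    have ac: "a \<in> carrier W" "b \<in> carrier W" using a b by auto
    obtain Z where Z: "Z \<in> lists S" "red x @ Z \<approx> U" using less.prems unfolding left_div_def by blast
    obtain Z' where Z': "Z' \<in> lists S" "red y @ Z' \<approx> U" using less.prems unfolding left_div_def by blast
    define X where "X = red (a \<otimes> x) @ Z"
    define Y where "Y = red (b \<otimes> y) @ Z'"
    have UX: "a # X \<approx> U"
      using braid_trans[OF word_cong_append[OF word_cong.sym[OF red_inversion[OF a(1) c(1) a(2)]]
          braid_refl[OF Z(1)]] Z(2)]
      unfolding X_def by simp
    have UY: "b # Y \<approx> U"
      using braid_trans[OF word_cong_append[OF word_cong.sym[OF red_inversion[OF b(1) c(2) b(2)]]
          braid_refl[OF Z'(1)]] Z'(2)]
      unfolding Y_def by simp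
    have lX: "Suc (length X) = length U" "Suc (length Y) = length U"
      using braid_equiv_length[OF UX] braid_equiv_length[OF UY] by auto
    have redn: "reduction (length X)" "reduction (length Y)" using less.prems lX by auto
    have "a # X \<approx> b # Y" by (rule braid_trans[OF UX word_cong.sym[OF UY]])
    then have "common_head a X b Y" using redn(1) unfolding reduction_def by blast
    then obtain K R where K: "K \<in> carrier W" "R \<in> lists S" "a \<in> inversions K" "b \<in> inversions K"
      and XK: "X \<approx> red (a \<otimes> K) @ R"
      unfolding common_head_def by blast
    \<comment> \<open>Lying below K, the element p divides U; containing both a and b, it ensures
      that the divisor q built on the a side can be continued on the b side.\<close>
    obtain p where p: "p \<in> carrier W" "a \<in> inversions p" "b \<in> inversions p" "inversions p \<subseteq> inversions K"
      using gen_join_exists[OF a(1) b(1)] K by blast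
    have "inversions (a \<otimes> p) \<subseteq> inversions (a \<otimes> K)"
      using inversions_subset_gen_translate[of a p K] a p K by blast
    then have "red (a \<otimes> p) \<preceq> red (a \<otimes> K)" using red_left_div p K ac by simp
    also have "red (a \<otimes> K) \<preceq> red (a \<otimes> K) @ R" using left_div_append red_lists K ac by simp
    also have "red (a \<otimes> K) @ R \<approx> X" using XK word_cong.sym by blast
    finally have pX: "red (a \<otimes> p) \<preceq> X" .
    have xX: "red (a \<otimes> x) \<preceq> X"
      unfolding X_def using left_div_append red_lists c ac Z by simp
    obtain j1 where j1: "is_join (a \<otimes> x) (a \<otimes> p) j1"
      using is_join_exists c p ac by (metis m_closed)
    then have j1c: "j1 \<in> carrier W" by (simp add: is_join_def)
    have "red j1 \<preceq> X"
      using less.hyps[of X "a \<otimes> x" "a \<otimes> p" j1] less.prems(1,2) lX c p ac xX pX j1 by simp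
    have aj1: "a \<notin> inversions j1"
      using is_join_gen_notin[OF j1 a(1)] len_gen_mult_less(2)[OF a(1)] a c p ac by simp
    define q where "q = a \<otimes> j1"
    have q: "q \<in> carrier W" "a \<in> inversions q" "a \<otimes> q = j1"
      using j1c a aj1 gen_mem_inversions_mult by (auto simp: q_def)
    have xq: "inversions x \<subseteq> inversions q" and pq: "inversions p \<subseteq> inversions q"
      using inversions_subset_gen_translate[of a x q] inversions_subset_gen_translate[of a p q] a c p q j1
      by (auto simp: is_join_def)
    have "red q \<approx> a # red j1" unfolding q_def using red_gen_mult a j1c aj1 by simp
    also have "a # red j1 \<preceq> a # X" using left_div_Cons a \<open>red j1 \<preceq> X\<close> by simp
    also have "a # X \<approx> U" by fact
    finally have "red q \<preceq> U" .
    then obtain Z3 where Z3: "Z3 \<in> lists S" "red q @ Z3 \<approx> U" unfolding left_div_def by blast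
    have bq: "b \<in> inversions q" using p pq by blast
    have "(b # red (b \<otimes> q)) @ Z3 \<approx> red q @ Z3"
      using word_cong_append[OF word_cong.sym[OF red_inversion[OF b(1) q(1) bq]] braid_refl[OF Z3(1)]] .
    also have "red q @ Z3 \<approx> U" by fact
    also have "U \<approx> b # Y" using UY word_cong.sym by blast
    finally have "b # Y \<approx> b # (red (b \<otimes> q) @ Z3)" using word_cong.sym by simp
    \<comment> \<open>The divisor q starts with b, so cancelling b moves its remainder from U into
      Y.\<close>
    then have "Y \<approx> red (b \<otimes> q) @ Z3" using reduction_cancel redn by blast
    then have qY: "red (b \<otimes> q) \<preceq> Y"
      unfolding left_div_def using Z3 word_cong.sym by blast
    have yY: "red (b \<otimes> y) \<preceq> Y"
      unfolding Y_def using left_div_append red_lists c ac Z' by simp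
    obtain j2 where j2: "is_join (b \<otimes> q) (b \<otimes> y) j2"
      using is_join_exists c q ac by (metis m_closed)
    then have j2c: "j2 \<in> carrier W" by (simp add: is_join_def)
    have "red j2 \<preceq> Y"
      using less.hyps[of Y "b \<otimes> q" "b \<otimes> y" j2] less.prems(1,2) lX c q ac yY qY j2 by simp
    have bj2: "b \<notin> inversions j2"
      using is_join_gen_notin[OF j2 b(1)] len_gen_mult_less(2)[OF b(1)] b bq c q ac by simp
    define r where "r = b \<otimes> j2"
    have r: "r \<in> carrier W" "b \<in> inversions r" "b \<otimes> r = j2"
      using j2c b bj2 gen_mem_inversions_mult by (auto simp: r_def)
    have "inversions q \<subseteq> inversions r" "inversions y \<subseteq> inversions r"
      using inversions_subset_gen_translate[of b q r] inversions_subset_gen_translate[of b y r] b bq c q r j2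
      by (auto simp: is_join_def)
    then have "inversions j \<subseteq> inversions r"
      using less.prems(7) xq r unfolding is_join_def by blast
    then have "red j \<preceq> red r" using red_left_div jc r by simp
    also have "red r \<approx> b # red j2" unfolding r_def using red_gen_mult b j2c bj2 by simp
    also have "b # red j2 \<preceq> b # Y" using left_div_Cons b \<open>red j2 \<preceq> Y\<close> by simp
    also have "b # Y \<approx> U" by fact
    finally show ?thesis .
  qed
qed

text \<open>The middle tail U has two simple prefixes, from K and from K'. Their join j still
  divides U, and L = c j is a simple element above both K and K'; the complement Q of j in U serves
  as common remainder.\<close>

lemma common_head_trans:
  assumes "\<forall>k<length U. reduction k" "common_head a X c U" "common_head c U b Y"
    and S: "a \<in> S" "b \<in> S" "c \<in> S"
  shows "common_head a X b Y"
proof -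
  obtain K R where K: "K \<in> carrier W" "R \<in> lists S" "a \<in> inversions K" "c \<in> inversions K"
    and X: "X \<approx> red (a \<otimes> K) @ R" and UK: "U \<approx> red (c \<otimes> K) @ R"
    using assms(2) unfolding common_head_def by blast
  obtain K' R' where K': "K' \<in> carrier W" "R' \<in> lists S" "c \<in> inversions K'" "b \<in> inversions K'"
    and UK': "U \<approx> red (c \<otimes> K') @ R'" and Y: "Y \<approx> red (b \<otimes> K') @ R'"
    using assms(3) unfolding common_head_def by blast
  have cc: "c \<otimes> K \<in> carrier W" "c \<otimes> K' \<in> carrier W" using K K' S by auto
  obtain j where j: "is_join (c \<otimes> K) (c \<otimes> K') j" using is_join_exists cc by blast
  then have jc: "j \<in> carrier W" by (simp add: is_join_def)
  have "red (c \<otimes> K) \<preceq> U" "red (c \<otimes> K') \<preceq> U"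
    unfolding left_div_def using K K' UK UK' word_cong.sym by blast+
  then have "red j \<preceq> U" using reduction_red_join[OF assms(1) _ cc _ _ j] by simp
  then obtain Q where Q: "Q \<in> lists S" "red j @ Q \<approx> U" unfolding left_div_def by blast
  define L where "L = c \<otimes> j"
  have cj: "c \<notin> inversions j"
    using is_join_gen_notin[OF j S(3) cc] len_gen_mult_less(2)[OF S(3)] K K' by simp
  have L: "L \<in> carrier W" "c \<in> inversions L" "c \<otimes> L = j"
    using jc S cj gen_mem_inversions_mult by (auto simp: L_def)
  \<comment> \<open>Both halves follow the same pattern, with M standing for K or K': write L as M
    w, cancel the prefix \<open>c \<otimes> M\<close> from U to see that T is w followed by Q, and
    substitute in V.\<close>
  have key: "x \<in> inversions L \<and> V \<approx> red (x \<otimes> L) @ Q"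
    if x: "x \<in> S" and M: "M \<in> carrier W" "T \<in> lists S" "x \<in> inversions M" "c \<in> inversions M"
      and V: "V \<approx> red (x \<otimes> M) @ T" and UM: "U \<approx> red (c \<otimes> M) @ T"
      and jM: "inversions (c \<otimes> M) \<subseteq> inversions j" for x V M T
  proof -
    have subL: "inversions M \<subseteq> inversions L"
      using inversions_subset_gen_translate[of c M L] S M L jM by simp
    then have xL: "x \<in> inversions L" using M by blast
    define w where "w = inv M \<otimes> L"
    have wc: "w \<in> carrier W" using M L by (simp add: w_def)
    have "red j \<approx> red (c \<otimes> M) @ red w"
      using red_prefix[of "c \<otimes> M" j] jM M S jc by (simp add: w_def L_def inv_mult_group m_assoc)
    then have "red j @ Q \<approx> (red (c \<otimes> M) @ red w) @ Q" using Q by (intro word_cong_append braid_refl)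
    then have "red (c \<otimes> M) @ (red w @ Q) \<approx> red (c \<otimes> M) @ T"
      using Q(2) UM braid_trans word_cong.sym by (metis append.assoc)
    moreover have "length (red (c \<otimes> M) @ (red w @ Q)) \<le> length U"
      using braid_equiv_length[OF calculation] braid_equiv_length[OF UM] by simp
    ultimately have T: "red w @ Q \<approx> T" using reduction_cancel_word[OF assms(1)] by blast
    have "inversions (x \<otimes> M) \<subseteq> inversions (x \<otimes> L)"
      using inversions_subset_gen_translate[of x M L] x M L xL subL by simp
    then have xw: "red (x \<otimes> L) \<approx> red (x \<otimes> M) @ red w"
      using red_prefix[of "x \<otimes> M" "x \<otimes> L"] x M L by (simp add: w_def inv_mult_group m_assoc)
    have "V \<approx> red (x \<otimes> M) @ T" by fact
    also have "red (x \<otimes> M) @ T \<approx> red (x \<otimes> M) @ (red w @ Q)"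
      using T word_cong.sym red_lists x M by (intro word_cong_append braid_refl) auto
    also have "red (x \<otimes> M) @ (red w @ Q) = (red (x \<otimes> M) @ red w) @ Q" by simp
    also have "\<dots> \<approx> red (x \<otimes> L) @ Q"
      using xw Q word_cong.sym by (intro word_cong_append braid_refl)
    finally show ?thesis using xL by blast
  qed
  have "a \<in> inversions L \<and> X \<approx> red (a \<otimes> L) @ Q"
    using key[OF S(1) K X UK] j by (simp add: is_join_def)
  moreover have "b \<in> inversions L \<and> Y \<approx> red (b \<otimes> L) @ Q"
    using key[OF S(2) K'(1,2,4,3) Y UK'] j by (simp add: is_join_def)
  ultimately show ?thesis unfolding common_head_def using L Q by blast
qed

text \<open>Here K is the common product in W of the two sides of the relation, and the rest of the
  word is the remainder.\<close>

lemma common_head_braid_move: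
  assumes "s \<in> S" "t \<in> S" "s \<noteq> t" "v \<in> lists S"
    and "alternating (coxeter_mat W s t) s t @ v = a # X"
    and "alternating (coxeter_mat W s t) t s @ v = b # Y"
  shows "common_head a X b Y"
proof -
  let ?k = "coxeter_mat W s t"
  let ?p = "word_prod W (alternating ?k s t)"
  obtain n where n: "?k = Suc n" using coxeter_mat_pos[OF assms(1,2)] gr0_implies_Suc by blast
  have ab: "a = s" "b = t" "X = alternating n t s @ v" "Y = alternating n s t @ v"
    using assms n by auto
  have 1: "reduced_word W S (s # alternating n t s) ?p"
    using reduced_word_alternating[OF assms(1,2)] n by simp
  have 2: "reduced_word W S (t # alternating n s t) ?p"
    using reduced_word_alternating[OF assms(2,1)] n coxeter_mat_sym[OF assms(1,2)]
      alternating_prod_sym[OF assms(1,2)] by simp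
  note pc = reduced_word_carrier[OF 1]
  have "alternating n t s \<approx> red (s \<otimes> ?p)" "alternating n s t \<approx> red (t \<otimes> ?p)"
    using matsumoto reduced_word_ConsD(3)[OF 1] reduced_word_ConsD(3)[OF 2] reduced_word_red pc assms(1,2)
    by (metis gen_carrier m_closed)+
  then have "X \<approx> red (s \<otimes> ?p) @ v" "Y \<approx> red (t \<otimes> ?p) @ v"
    unfolding ab using assms by (auto intro: word_cong_append braid_refl)
  then show ?thesis
    unfolding common_head_def ab(1,2)
    using pc assms(4) reduced_word_ConsD(2)[OF 1] reduced_word_ConsD(2)[OF 2] by blast
qed

text \<open>Outside, induction on the length; inside, induction on the derivation. A braid move past
  the first letter leaves the head fixed, one at the front is the dihedral case, and transitivity
  draws on smaller lengths.\<close>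

lemma reduction_all: "reduction n"
proof (induction n rule: less_induct)
  case (less n)
  have "common_head a X b Y" if "u \<approx> v" "u = a # X" "v = b # Y" "length X = n" for u v a X b Y
    using that
  proof (induction arbitrary: a X b Y rule: word_cong.induct)
    case (rel x y u v)
    obtain s t where st: "s \<in> S" "t \<in> S" "s \<noteq> t" "x = alternating (coxeter_mat W s t) s t"
      "y = alternating (coxeter_mat W s t) t s"
      using rel(1) unfolding braid_rels_def by blast
    show ?case
    proof (cases u)
      case Nil
      then show ?thesis using common_head_braid_move[OF st(1-3) \<open>v \<in> lists S\<close>] st rel by simp
    next
      case (Cons d u')
      then have "u' @ x @ v \<approx> u' @ y @ v" using rel by (intro word_cong.rel) auto
      then show ?thesis using Cons rel common_head_same by auto
    qed
  next
    case (refl u)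
    then show ?case by (auto intro: common_head_same braid_refl)
  next
    case (sym u v)
    then show ?case using braid_equiv_length[OF sym(1)] by (auto intro: common_head_sym)
  next
    case (trans u v w)
    obtain c U where v: "v = c # U"
      using braid_equiv_length[OF trans(1)] trans.prems by (cases v) auto
    have lU: "length U = n" using braid_equiv_length[OF trans(1)] trans.prems v by simp
    have "a \<in> S" "b \<in> S" "c \<in> S"
      using word_cong_lists[OF trans(1)] word_cong_lists[OF trans(2)] trans.prems v by auto
    then show ?case
      using common_head_trans[of U a X c b Y] trans.IH trans.prems v lU less by simp
  qed
  then show ?case unfolding reduction_def by blast
qed

section \<open>Left cancellation and least common multiples\<close>

lemma left_cancel: "u @ X \<approx> u @ Y \<Longrightarrow> X \<approx> Y"
  using reduction_cancel_word[of "length (u @ X)" u X Y] reduction_all by blast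

lemma left_div_Cons_cancel: "a # u \<preceq> a # v \<Longrightarrow> u \<preceq> v"
  unfolding left_div_def using left_cancel[of "[a]"] by fastforce

lemma left_div_ConsD:
  assumes "a # u \<preceq> v"
  obtains w where "a \<in> S" "v \<approx> a # w" "u \<preceq> w"
proof -
  obtain z where z: "z \<in> lists S" "a # (u @ z) \<approx> v" using assms unfolding left_div_def by auto
  have "a \<in> S" "u \<in> lists S" using left_div_lists[OF assms] by auto
  then show ?thesis using that[of "u @ z"] z left_div_append word_cong.sym by blast
qed

text \<open>Reduction supplies some K above a and b dividing d, and the minimality of p puts it
  below K.\<close>

lemma gen_join_left_div:
  assumes "p \<in> carrier W" "a # X \<approx> d" "b # Y \<approx> d"
    and "\<And>z. z \<in> carrier W \<Longrightarrow> a \<in> inversions z \<Longrightarrow> b \<in> inversions z \<Longrightarrow> inversions p \<subseteq> inversions z"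
  shows "red p \<preceq> d"
proof -
  have "a \<in> S" using word_cong_lists[OF assms(2)] by auto
  have "a # X \<approx> b # Y" using assms braid_trans word_cong.sym by blast
  then obtain K R where K: "K \<in> carrier W" "R \<in> lists S" "a \<in> inversions K" "b \<in> inversions K"
    and X: "X \<approx> red (a \<otimes> K) @ R"
    using reduction_all unfolding reduction_def common_head_def by blast
  have "red p \<preceq> red K" using red_left_div assms K by simp
  also have "red K \<preceq> red K @ R" using left_div_append red_lists K by blast
  also have "red K @ R \<approx> (a # red (a \<otimes> K)) @ R"
    using red_inversion K \<open>a \<in> S\<close> by (intro word_cong_append braid_refl) auto
  also have "(a # red (a \<otimes> K)) @ R = a # (red (a \<otimes> K) @ R)" by simp
  also have "a # (red (a \<otimes> K) @ R) \<approx> a # X" using X \<open>a \<in> S\<close> word_cong.sym braid_equiv_Cons by blast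
  also have "a # X \<approx> d" by fact
  finally show ?thesis .
qed

text \<open>The induction runs on the given common multiple c, which replaces the longest element as
  a bound. With p the join of the first letters, first join u with p after removing a, then join the
  result with v after removing b; both steps happen below proper remainders of c.\<close>

lemma lcm_exists:
  assumes "u \<preceq> c" "v \<preceq> c"
  shows "\<exists>j. u \<preceq> j \<and> v \<preceq> j \<and> (\<forall>d. u \<preceq> d \<longrightarrow> v \<preceq> d \<longrightarrow> j \<preceq> d)"
  using assms
proof (induction "length c" arbitrary: c u v rule: less_induct)
  case less
  have l: "u \<in> lists S" "v \<in> lists S" using less.prems left_div_lists by auto
  show ?case
  proof (cases "u = [] \<or> v = []")
    case True
    then show ?thesis using l left_div_Nil left_div_refl by blast
  next
    case False
    then obtain a u1 b v1 where uv: "u = a # u1" "v = b # v1" by (meson neq_Nil_conv)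
    obtain c1 where c1: "a \<in> S" "c \<approx> a # c1" "u1 \<preceq> c1"
      using left_div_ConsD less.prems(1) uv by blast
    obtain c2 where c2: "b \<in> S" "c \<approx> b # c2" "v1 \<preceq> c2"
      using left_div_ConsD less.prems(2) uv by blast
    obtain p where p: "p \<in> carrier W" "a \<in> inversions p" "b \<in> inversions p"
      and pmin: "\<And>z. z \<in> carrier W \<Longrightarrow> a \<in> inversions z \<Longrightarrow> b \<in> inversions z \<Longrightarrow> inversions p \<subseteq> inversions z"
      using gen_join_exists[OF c1(1) c2(1)] by blast
    define p1 p2 where "p1 = red (a \<otimes> p)" and "p2 = red (b \<otimes> p)"
    have pa: "red p \<approx> a # p1" and pb: "red p \<approx> b # p2"
      unfolding p1_def p2_def using red_inversion c1 c2 p by auto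
    have p_div: "a # p1 \<preceq> d" if "a # X \<approx> d" "b # Y \<approx> d" for X Y d
      using gen_join_left_div[OF p(1) that pmin] pa left_div_equiv_trans(1) word_cong.sym by blast
    have "a # p1 \<preceq> c" using p_div c1 c2 word_cong.sym by blast
    then have "p1 \<preceq> c1" using c1 left_div_equiv_trans(2) left_div_Cons_cancel by blast
    moreover have "length c1 < length c" using braid_equiv_length[OF c1(2)] by simp
    ultimately obtain j1 where j1: "u1 \<preceq> j1" "p1 \<preceq> j1"
      and j1min: "\<And>d. u1 \<preceq> d \<Longrightarrow> p1 \<preceq> d \<Longrightarrow> j1 \<preceq> d"
      using less.hyps c1(3) by blast
    \<comment> \<open>Being a multiple of p, the word \<open>a # j1\<close> can also be rewritten to
      start with b.\<close>
    have "b # p2 \<approx> a # p1" using pa pb braid_trans word_cong.sym by blast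
    also have "a # p1 \<preceq> a # j1" using left_div_Cons c1 j1 by blast
    finally obtain q2 where q2: "a # j1 \<approx> b # q2" using left_div_ConsD by blast
    have "b # q2 \<approx> a # j1" using q2 word_cong.sym by blast
    also have "a # j1 \<preceq> a # c1" using left_div_Cons c1 j1min \<open>p1 \<preceq> c1\<close> by blast
    also have "a # c1 \<approx> c" using c1 word_cong.sym by blast
    also have "c \<approx> b # c2" by fact
    finally have "q2 \<preceq> c2" by (rule left_div_Cons_cancel)
    moreover have "length c2 < length c" using braid_equiv_length[OF c2(2)] by simp
    ultimately obtain j2 where j2: "q2 \<preceq> j2" "v1 \<preceq> j2"
      and j2min: "\<And>d. q2 \<preceq> d \<Longrightarrow> v1 \<preceq> d \<Longrightarrow> j2 \<preceq> d"
      using less.hyps c2(3) by blast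
    have "u \<preceq> a # j1" using uv left_div_Cons c1 j1 by blast
    also have "a # j1 \<approx> b # q2" by fact
    also have "b # q2 \<preceq> b # j2" using left_div_Cons c2 j2 by blast
    finally have "u \<preceq> b # j2" .
    moreover have "v \<preceq> b # j2" using uv left_div_Cons c2 j2 by blast
    moreover have "b # j2 \<preceq> d" if d: "u \<preceq> d" "v \<preceq> d" for d
    proof -
      obtain d1 where d1: "d \<approx> a # d1" "u1 \<preceq> d1" using left_div_ConsD d(1) uv by blast
      obtain d2 where d2: "d \<approx> b # d2" "v1 \<preceq> d2" using left_div_ConsD d(2) uv by blast
      have "a # p1 \<preceq> a # d1" using p_div d1 d2 word_cong.sym left_div_equiv_trans(2) by blast
      then have "j1 \<preceq> d1" using left_div_Cons_cancel j1min d1 by blast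
      have "b # q2 \<approx> a # j1" using q2 word_cong.sym by blast
      also have "a # j1 \<preceq> a # d1" using left_div_Cons c1 \<open>j1 \<preceq> d1\<close> by blast
      also have "a # d1 \<approx> d" using d1 word_cong.sym by blast
      also have "d \<approx> b # d2" by fact
      finally have "q2 \<preceq> d2" by (rule left_div_Cons_cancel)
      then have "j2 \<preceq> d2" using j2min d2 by blast
      then have "b # j2 \<preceq> b # d2" using left_div_Cons c2 by blast
      then show ?thesis using d2 word_cong.sym left_div_equiv_trans(2) by blast
    qed
    ultimately show ?thesis by blast
  qed
qed

end

section \<open>Duality\<close>

lemma lattice_of_joins_and_antitone_involution:
  assumes "partial_order L"
    and sup: "\<And>x y. x \<in> carrier L \<Longrightarrow> y \<in> carrier L \<Longrightarrow> \<exists>s. least L s (Upper L {x, y})"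
    and f: "\<And>x. x \<in> carrier L \<Longrightarrow> f x \<in> carrier L" "\<And>x. x \<in> carrier L \<Longrightarrow> f (f x) = x"
    and anti: "\<And>x y. x \<in> carrier L \<Longrightarrow> y \<in> carrier L \<Longrightarrow> x \<sqsubseteq>\<^bsub>L\<^esub> y \<Longrightarrow> f y \<sqsubseteq>\<^bsub>L\<^esub> f x"
  shows "lattice L" "self_dual L"
proof -
  interpret partial_order L by fact
  have "\<exists>s. greatest L s (Lower L {x, y})" if xy: "x \<in> carrier L" "y \<in> carrier L" for x y
  proof -
    obtain j where j: "least L j (Upper L {f x, f y})" using sup f xy by blast
    then have jc: "j \<in> carrier L" and ub: "f x \<sqsubseteq>\<^bsub>L\<^esub> j" "f y \<sqsubseteq>\<^bsub>L\<^esub> j"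
      using f xy by (auto simp: least_def Upper_def)
    have jmin: "j \<sqsubseteq>\<^bsub>L\<^esub> k" if "k \<in> carrier L" "f x \<sqsubseteq>\<^bsub>L\<^esub> k" "f y \<sqsubseteq>\<^bsub>L\<^esub> k" for k
      using j that f xy by (auto simp: least_def Upper_def)
    have "f j \<sqsubseteq>\<^bsub>L\<^esub> x" "f j \<sqsubseteq>\<^bsub>L\<^esub> y"
      using anti[OF f(1)[OF xy(1)] jc ub(1)] anti[OF f(1)[OF xy(2)] jc ub(2)] f(2) xy by simp_all
    moreover have "l \<sqsubseteq>\<^bsub>L\<^esub> f j" if "l \<in> carrier L" "l \<sqsubseteq>\<^bsub>L\<^esub> x" "l \<sqsubseteq>\<^bsub>L\<^esub> y" for l
    proof -
      have "j \<sqsubseteq>\<^bsub>L\<^esub> f l"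
        by (rule jmin[OF f(1)[OF that(1)] anti[OF that(1) xy(1) that(2)] anti[OF that(1) xy(2) that(3)]])
      from anti[OF jc f(1)[OF that(1)] this] show ?thesis using f(2)[OF that(1)] by simp
    qed
    ultimately have "greatest L (f j) (Lower L {x, y})"
      using f jc xy by (auto simp: greatest_def Lower_def)
    then show ?thesis ..
  qed
  then show "lattice L"
    by unfold_locales (use sup in blast)+
  have "bij_betw f (carrier L) (carrier L)"
    by (rule bij_betw_byWitness[of _ f]) (use f in auto)
  moreover have "x \<sqsubseteq>\<^bsub>L\<^esub> y \<longleftrightarrow> f y \<sqsubseteq>\<^bsub>L\<^esub> f x" if "x \<in> carrier L" "y \<in> carrier L" for x y
    using anti[OF that] anti[OF f(1)[OF that(2)] f(1)[OF that(1)]] f(2) that by auto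
  ultimately show "self_dual L" unfolding self_dual_def by blast
qed

lemma rank_symmetric_of_involution:
  assumes f: "\<And>x. x \<in> carrier L \<Longrightarrow> f x \<in> carrier L" "\<And>x. x \<in> carrier L \<Longrightarrow> f (f x) = x"
    and rk: "\<And>x. x \<in> carrier L \<Longrightarrow> rk x + rk (f x) = n"
  shows "rank_symmetric L rk n"
  unfolding rank_symmetric_def
proof (intro allI impI)
  fix i assume "i \<le> n"
  have "rk (f x) = n - i" if "x \<in> carrier L" "rk x = i" for x
    using rk[OF that(1)] that(2) by simp
  moreover have "rk (f x) = i" if "x \<in> carrier L" "rk x = n - i" for x
    using rk[OF that(1)] that(2) \<open>i \<le> n\<close> by simp
  ultimately have "bij_betw f {x \<in> carrier L. rk x = i} {x \<in> carrier L. rk x = n - i}"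
    using f by (intro bij_betw_byWitness[of _ f]) auto
  then show "card {x \<in> carrier L. rk x = i} = card {x \<in> carrier L. rk x = n - i}"
    by (rule bij_betw_same_card)
qed

context finite_coxeter_system
begin

section \<open>The Artin monoid as classes of words\<close>

abbreviation braid_class :: "'a list \<Rightarrow> 'a list set" where
  "braid_class u \<equiv> word_cong S (braid_rels W S) `` {u}"

lemma equiv_braid: "equiv (lists S) (word_cong S (braid_rels W S))"
proof (rule equivI)
  show "word_cong S (braid_rels W S) \<subseteq> lists S \<times> lists S"
    using word_cong_lists by (intro subrelI SigmaI) blast+
  show "refl_on (lists S) (word_cong S (braid_rels W S))"
    by (rule refl_onI) (rule braid_refl)
  show "sym (word_cong S (braid_rels W S))"
    by (rule symI) (rule word_cong.sym)
  show "trans (word_cong S (braid_rels W S))"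
    by (rule transI) (rule word_cong.trans)
qed

lemma braid_class_eq_iff:
  "u \<in> lists S \<Longrightarrow> v \<in> lists S \<Longrightarrow> braid_class u = braid_class v \<longleftrightarrow> u \<approx> v"
  by (rule eq_equiv_class_iff[OF equiv_braid])

lemma artin_carrier: "carrier (artin_monoid W S) = braid_class ` lists S"
  unfolding artin_monoid_def presented_monoid_def by (auto simp: quotient_def)

lemma artin_mult:
  assumes "u \<in> lists S" "v \<in> lists S"
  shows "braid_class u \<otimes>\<^bsub>artin_monoid W S\<^esub> braid_class v = braid_class (u @ v)"
proof -
  have "braid_class (x @ y) = braid_class (u @ v)" if "u \<approx> x" "v \<approx> y" for x y
    using word_cong_append[OF that] equiv_class_eq[OF equiv_braid] by metis
  \<comment> \<open>All representatives yield the same class, but the double union equals that class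
    only because both index sets are inhabited.\<close>
  moreover have "braid_class u \<noteq> {}" "braid_class v \<noteq> {}" using assms braid_refl by blast+
  ultimately have "(\<Union>x\<in>braid_class u. \<Union>y\<in>braid_class v. braid_class (x @ y)) = braid_class (u @ v)"
    by (intro SUP_eq_const) (simp_all only: Image_singleton_iff not_False_eq_True)
  then show ?thesis
    unfolding artin_monoid_def presented_monoid_def by simp
qed

lemma artin_one: "\<one>\<^bsub>artin_monoid W S\<^esub> = braid_class []"
  unfolding artin_monoid_def presented_monoid_def by simp

lemma artin_pow:
  assumes "u \<in> lists S"
  shows "braid_class u [^]\<^bsub>artin_monoid W S\<^esub> (n::nat) = braid_class (concat (replicate n u))"
proof (induction n)
  case (Suc n)
  have "concat (replicate n u) \<in> lists S" using assms by (induction n) auto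
  \<comment> \<open>Monoid powers grow on the right, while \<open>replicate\<close> adds its new
    copy on the left.\<close>
  moreover have "concat (replicate n u) @ u = u @ concat (replicate n u)" by (induction n) auto
  ultimately show ?case using Suc artin_mult assms by simp
qed (simp add: artin_one)

lemma weak_le_iff:
  assumes "u \<in> lists S" "v \<in> lists S"
  shows "weak_le W S (braid_class u) (braid_class v) \<longleftrightarrow> u \<preceq> v"
proof -
  have "braid_class u \<otimes>\<^bsub>artin_monoid W S\<^esub> braid_class z = braid_class v \<longleftrightarrow> u @ z \<approx> v"
    if z: "z \<in> lists S" for z
  proof -
    have "u @ z \<in> lists S" using assms(1) z by simp
    then show ?thesis
      unfolding artin_mult[OF assms(1) z] by (rule braid_class_eq_iff[OF _ assms(2)])
  qed
  then show ?thesis unfolding weak_le_def left_div_def artin_carrier by blast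
qed

lemma artin_length_class:
  assumes "u \<in> lists S"
  shows "artin_length (braid_class u) = length u"
  unfolding artin_length_def
proof (rule the_equality)
  show "\<forall>ws \<in> braid_class u. length ws = length u"
    using braid_equiv_length[OF word_cong.sym] by blast
  show "n = length u" if "\<forall>ws \<in> braid_class u. length ws = n" for n
    using that braid_refl[OF assms] by simp
qed

lemma artin_lift_eq:
  assumes "w \<in> carrier W"
  shows "artin_lift W S w = braid_class (red w)"
  unfolding artin_lift_def
proof (rule the_equality)
  show "\<exists>ws. reduced_word W S ws w \<and> braid_class (red w) = braid_class ws"
    using reduced_word_red[OF assms] by blast
  show "b = braid_class (red w)" if "\<exists>ws. reduced_word W S ws w \<and> b = braid_class ws" for b
    using that matsumoto reduced_word_red[OF assms] equiv_class_eq[OF equiv_braid] by blast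
qed

text \<open>An alternating word of odd length is a palindrome, and one of even length reverses to
  the other side of its braid relation, so reversal respects every relation.\<close>

lemma braid_equiv_rev: "u \<approx> v \<Longrightarrow> rev u \<approx> rev v"
proof (induction rule: word_cong.induct)
  case (rel x y u v)
  obtain s t where st: "s \<in> S" "t \<in> S" "s \<noteq> t" "x = alternating (coxeter_mat W s t) s t"
    "y = alternating (coxeter_mat W s t) t s"
    using rel(1) unfolding braid_rels_def by blast
  have "rev x \<approx> rev y"
    using braid_move[OF st(1-3)] word_cong.sym[OF braid_move[OF st(1-3)]]
    unfolding st(4,5) rev_alternating by auto
  then have "rev v @ rev x @ rev u \<approx> rev v @ rev y @ rev u"
    using rel by (intro word_cong_context) auto
  then show ?case by simp
next
  case (refl u)
  then show ?case by (intro braid_refl) auto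
next
  case (sym u v)
  then show ?case by (blast intro: word_cong.sym)
next
  case (trans u v w)
  then show ?case by (blast intro: word_cong.trans)
qed

lemma len_inv_le:
  assumes "x \<in> carrier W"
  shows "len (inv x) \<le> len x"
proof -
  have "rev (red x) \<in> lists S" using red_lists[OF assms] by auto
  moreover have "word_prod W (rev (red x)) = inv x" "length (red x) = len x"
    using reduced_word_red[OF assms] word_prod_rev[of "red x"] by (simp_all add: reduced_word_iff)
  ultimately show ?thesis using len_le[of "rev (red x)"] by simp
qed

text \<open>Inversion preserves length, and a subset of the top inversion set with the same
  cardinality is the whole set.\<close>

lemma longest_element_inv: "inv (longest_element W S) = longest_element W S"
proof -
  let ?w = "longest_element W S"
  note top = longest_element
  have "len (inv ?w) = len ?w" using len_inv_le[of ?w] len_inv_le[of "inv ?w"] top(1) by simp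
  then have "inversions (inv ?w) = inversions ?w"
    using top by (intro card_subset_eq) auto
  then show ?thesis using inversions_inj top(1) by simp
qed

definition garside_power :: "nat \<Rightarrow> 'a list" where
  "garside_power m = concat (replicate m (red (longest_element W S)))"

lemma garside_power_lists: "garside_power m \<in> lists S"
  unfolding garside_power_def using red_lists[OF longest_element(1)] by (induction m) auto

lemma length_garside_power:
  "length (garside_power m) = m * coxeter_length W S (longest_element W S)"
  using reduced_word_red[OF longest_element(1)]
  unfolding garside_power_def reduced_word_def by (induction m) auto

lemma rev_red_longest: "rev (red (longest_element W S)) \<approx> red (longest_element W S)"
proof (rule matsumoto)
  let ?w = "longest_element W S"
  note r = reduced_word_red[OF longest_element(1)]
  show "reduced_word W S (red ?w) ?w" by (rule r)
  show "reduced_word W S (rev (red ?w)) ?w"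
    using r longest_element_inv word_prod_rev[of "red ?w"] by (auto simp: reduced_word_def)
qed

lemma rev_garside_power: "rev (garside_power m) \<approx> garside_power m"
proof (induction m)
  case (Suc m)
  let ?d = "red (longest_element W S)"
  have "garside_power m @ ?d = garside_power (Suc m)"
    unfolding garside_power_def by (induction m) auto
  moreover have "rev (garside_power (Suc m)) = rev (garside_power m) @ rev ?d"
    by (simp add: garside_power_def)
  ultimately show ?case
    using word_cong_append[OF Suc rev_red_longest] by simp
qed (simp add: garside_power_def braid_refl)

section \<open>The interval below a Garside power and its duality\<close>

lemma m_weak_order_carrier:
  "carrier (m_weak_order W S m) = braid_class ` {u. u \<preceq> garside_power m}"
proof -
  have top: "artin_lift W S (longest_element W S) [^]\<^bsub>artin_monoid W S\<^esub> m = braid_class (garside_power m)"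
    using longest_element(1) by (simp add: artin_lift_eq artin_pow red_lists garside_power_def)
  have "b \<in> carrier (m_weak_order W S m) \<longleftrightarrow>
      (\<exists>u \<in> lists S. b = braid_class u \<and> weak_le W S (braid_class u) (braid_class (garside_power m)))" for b
    unfolding m_weak_order_def top artin_carrier by auto
  then have *: "b \<in> carrier (m_weak_order W S m) \<longleftrightarrow>
      (\<exists>u \<in> lists S. b = braid_class u \<and> u \<preceq> garside_power m)" for b
    by (simp only: weak_le_iff[OF _ garside_power_lists] cong: bex_cong)
  have eq: "{u. u \<preceq> garside_power m} = {u \<in> lists S. u \<preceq> garside_power m}"
    using left_div_lists by blast
  show ?thesis
    unfolding eq by (rule Set.set_eqI) (auto simp only: * image_iff Bex_def mem_Collect_eq)
qed

lemma m_weak_order_le: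
  "u \<in> lists S \<Longrightarrow> v \<in> lists S \<Longrightarrow>
    braid_class u \<sqsubseteq>\<^bsub>m_weak_order W S m\<^esub> braid_class v \<longleftrightarrow> u \<preceq> v"
  by (simp add: m_weak_order_def weak_le_iff)

text \<open>Lengths add under concatenation and are braid invariant, so mutual divisibility forces
  empty quotients.\<close>

lemma left_div_antisym:
  assumes "u \<preceq> v" "v \<preceq> u"
  shows "u \<approx> v"
proof -
  obtain y z where yz: "u @ y \<approx> v" "v @ z \<approx> u" using assms unfolding left_div_def by blast
  have "length y = 0"
    using braid_equiv_length[OF yz(1)] braid_equiv_length[OF yz(2)] unfolding length_append by linarith
  then show ?thesis using yz by simp
qed

lemma partial_order_m_weak_order: "partial_order (m_weak_order W S m)"
proof -
  let ?L = "m_weak_order W S m"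
  have le: "braid_class u \<sqsubseteq>\<^bsub>?L\<^esub> braid_class v \<longleftrightarrow> u \<preceq> v"
    if "u \<preceq> garside_power m" "v \<preceq> garside_power m" for u v
    using m_weak_order_le left_div_lists that by blast
  have eq: "x .=\<^bsub>?L\<^esub> y \<longleftrightarrow> x = y" for x y by (simp add: m_weak_order_def)
  show ?thesis
  proof
    fix x y z
    assume "x \<in> carrier ?L"
    then obtain u where u: "x = braid_class u" "u \<preceq> garside_power m"
      unfolding m_weak_order_carrier by blast
    show "x \<sqsubseteq>\<^bsub>?L\<^esub> x" using le u left_div_refl left_div_lists by blast
    assume "y \<in> carrier ?L"
    then obtain v where v: "y = braid_class v" "v \<preceq> garside_power m"
      unfolding m_weak_order_carrier by blast
    show "x \<sqsubseteq>\<^bsub>?L\<^esub> y \<Longrightarrow> y \<sqsubseteq>\<^bsub>?L\<^esub> x \<Longrightarrow> x .=\<^bsub>?L\<^esub> y"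
      using le u v left_div_antisym braid_class_eq_iff left_div_lists eq by metis
    assume "z \<in> carrier ?L"
    then obtain w where w: "z = braid_class w" "w \<preceq> garside_power m"
      unfolding m_weak_order_carrier by blast
    show "x \<sqsubseteq>\<^bsub>?L\<^esub> y \<Longrightarrow> y \<sqsubseteq>\<^bsub>?L\<^esub> z \<Longrightarrow> x \<sqsubseteq>\<^bsub>?L\<^esub> z"
      using le u v w left_div_trans by blast
  qed (auto simp: m_weak_order_def)
qed

lemma m_weak_order_joins:
  assumes "x \<in> carrier (m_weak_order W S m)" "y \<in> carrier (m_weak_order W S m)"
  shows "\<exists>s. least (m_weak_order W S m) s (Upper (m_weak_order W S m) {x, y})"
proof -
  let ?L = "m_weak_order W S m" and ?C = "garside_power m"
  obtain u v where u: "x = braid_class u" "u \<preceq> ?C" and v: "y = braid_class v" "v \<preceq> ?C"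
    using assms unfolding m_weak_order_carrier by blast
  obtain j where j: "u \<preceq> j" "v \<preceq> j" and jmin: "\<And>d. u \<preceq> d \<Longrightarrow> v \<preceq> d \<Longrightarrow> j \<preceq> d"
    using lcm_exists[OF u(2) v(2)] by blast
  have l: "u \<in> lists S" "v \<in> lists S" "j \<in> lists S" using j left_div_lists by auto
  have "braid_class j \<in> carrier ?L"
    unfolding m_weak_order_carrier using jmin u v by blast
  moreover have "x \<sqsubseteq>\<^bsub>?L\<^esub> braid_class j" "y \<sqsubseteq>\<^bsub>?L\<^esub> braid_class j"
    using j l u v m_weak_order_le by auto
  moreover have "braid_class j \<sqsubseteq>\<^bsub>?L\<^esub> z" if z: "z \<in> carrier ?L" "x \<sqsubseteq>\<^bsub>?L\<^esub> z" "y \<sqsubseteq>\<^bsub>?L\<^esub> z" for z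
  proof -
    obtain d where d: "z = braid_class d" "d \<in> lists S"
      using z left_div_lists unfolding m_weak_order_carrier by blast
    then have "u \<preceq> d" "v \<preceq> d" using z u v l m_weak_order_le by auto
    then show ?thesis using jmin d l m_weak_order_le by auto
  qed
  ultimately have "least ?L (braid_class j) (Upper ?L {x, y})"
    using assms by (auto simp: least_def Upper_def)
  then show ?thesis ..
qed

text \<open>The choice ranges over resulting classes: equivalent u have equivalent complements z by
  left cancellation, and reversal preserves equivalence, so only one value qualifies for elements of
  the interval.\<close>

definition rev_complement :: "nat \<Rightarrow> 'a list set \<Rightarrow> 'a list set" where
  "rev_complement m b = (SOME c. \<exists>u \<in> lists S. \<exists>z \<in> lists S.
    b = braid_class u \<and> u @ z \<approx> garside_power m \<and> c = braid_class (rev z))"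

lemma rev_complement_eq:
  assumes "u \<in> lists S" "z \<in> lists S" "u @ z \<approx> garside_power m"
  shows "rev_complement m (braid_class u) = braid_class (rev z)"
  unfolding rev_complement_def
proof (rule some_equality)
  fix c assume "\<exists>v \<in> lists S. \<exists>y \<in> lists S.
    braid_class u = braid_class v \<and> v @ y \<approx> garside_power m \<and> c = braid_class (rev y)"
  then obtain v y where v: "v \<in> lists S" "y \<in> lists S" "v @ y \<approx> garside_power m"
    and "braid_class u = braid_class v" and c: "c = braid_class (rev y)"
    by blast
  then have "u \<approx> v" using braid_class_eq_iff[OF assms(1) v(1)] by blast
  then have "u @ y \<approx> v @ y" using v by (intro word_cong_append braid_refl)
  also have "v @ y \<approx> garside_power m" by fact
  also have "garside_power m \<approx> u @ z" using assms(3) by (rule word_cong.sym)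
  finally have "rev y \<approx> rev z" by (rule braid_equiv_rev[OF left_cancel])
  then show "c = braid_class (rev z)" unfolding c by (rule equiv_class_eq[OF equiv_braid])
qed (use assms in blast)

lemma rev_complement_properties:
  assumes "x \<in> carrier (m_weak_order W S m)"
  obtains u z where "u \<in> lists S" "z \<in> lists S" "u @ z \<approx> garside_power m"
    "x = braid_class u" "rev_complement m x = braid_class (rev z)" "rev z @ rev u \<approx> garside_power m"
proof -
  obtain u where u: "x = braid_class u" "u \<preceq> garside_power m"
    using assms unfolding m_weak_order_carrier by blast
  then obtain z where z: "z \<in> lists S" "u @ z \<approx> garside_power m" unfolding left_div_def by blast
  have "rev (u @ z) \<approx> garside_power m"
    by (rule braid_trans[OF braid_equiv_rev[OF z(2)] rev_garside_power])
  moreover have "u \<in> lists S" using u left_div_lists by blast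
  ultimately show ?thesis
    using that[of u z] u(1) z rev_complement_eq[of u z] by simp
qed

lemma rev_complement_closed:
  assumes "x \<in> carrier (m_weak_order W S m)"
  shows "rev_complement m x \<in> carrier (m_weak_order W S m)"
proof -
  obtain u z where uz: "u \<in> lists S" "z \<in> lists S" "u @ z \<approx> garside_power m"
    "x = braid_class u" "rev_complement m x = braid_class (rev z)" "rev z @ rev u \<approx> garside_power m"
    by (rule rev_complement_properties[OF assms])
  have "rev u \<in> lists S" using uz(1) by auto
  then have "rev z \<preceq> garside_power m" unfolding left_div_def using uz(6) by (rule bexI[rotated])
  then show ?thesis unfolding m_weak_order_carrier uz(5) by (intro imageI CollectI)
qed

text \<open>Reversing the factorisation of the Garside power makes \<open>rev u\<close> the
  complement of \<open>rev z\<close>, and the second reversal restores u.\<close>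

lemma rev_complement_involution:
  assumes "x \<in> carrier (m_weak_order W S m)"
  shows "rev_complement m (rev_complement m x) = x"
proof -
  obtain u z where uz: "u \<in> lists S" "z \<in> lists S" "u @ z \<approx> garside_power m"
    "x = braid_class u" "rev_complement m x = braid_class (rev z)" "rev z @ rev u \<approx> garside_power m"
    by (rule rev_complement_properties[OF assms])
  have "rev z \<in> lists S" "rev u \<in> lists S" using uz(1,2) by auto
  from rev_complement_eq[OF this uz(6)] show ?thesis unfolding uz(5) by (simp only: rev_rev_ident uz(4))
qed

text \<open>If v is u w and z completes v, then w z completes u; reversed, this is
  \<open>rev z @ rev w\<close>, which has \<open>rev z\<close> as a prefix.\<close>

lemma rev_complement_antitone:
  assumes "x \<in> carrier (m_weak_order W S m)" "y \<in> carrier (m_weak_order W S m)"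
    and "x \<sqsubseteq>\<^bsub>m_weak_order W S m\<^esub> y"
  shows "rev_complement m y \<sqsubseteq>\<^bsub>m_weak_order W S m\<^esub> rev_complement m x"
proof -
  obtain u t where u: "u \<in> lists S" "t \<in> lists S" "u @ t \<approx> garside_power m"
    "x = braid_class u" "rev_complement m x = braid_class (rev t)" "rev t @ rev u \<approx> garside_power m"
    by (rule rev_complement_properties[OF assms(1)])
  obtain v z where v: "v \<in> lists S" "z \<in> lists S" "v @ z \<approx> garside_power m"
    "y = braid_class v" "rev_complement m y = braid_class (rev z)" "rev z @ rev v \<approx> garside_power m"
    by (rule rev_complement_properties[OF assms(2)])
  have "u \<preceq> v" using assms(3) unfolding u(4) v(4) m_weak_order_le[OF u(1) v(1)] .
  then obtain w where w: "w \<in> lists S" "u @ w \<approx> v" unfolding left_div_def by blast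
  have l: "rev z \<in> lists S" "rev w \<in> lists S" "w @ z \<in> lists S" "rev z @ rev w \<in> lists S"
    using v(2) w(1) by auto
  from braid_trans[OF word_cong_append[OF w(2) braid_refl[OF v(2)]] v(3)]
  have "u @ (w @ z) \<approx> garside_power m" by (simp only: append_assoc)
  from rev_complement_eq[OF u(1) l(3) this]
  have x: "rev_complement m x = braid_class (rev z @ rev w)" by (simp only: rev_append u(4))
  show ?thesis
    unfolding x v(5) m_weak_order_le[OF l(1,4)] by (rule left_div_append[OF l(1,2)])
qed

lemma rev_complement_length:
  assumes "x \<in> carrier (m_weak_order W S m)"
  shows "artin_length x + artin_length (rev_complement m x) =
    m * coxeter_length W S (longest_element W S)"
proof -
  obtain u z where uz: "u \<in> lists S" "z \<in> lists S" "u @ z \<approx> garside_power m"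
    "x = braid_class u" "rev_complement m x = braid_class (rev z)" "rev z @ rev u \<approx> garside_power m"
    by (rule rev_complement_properties[OF assms])
  have "rev z \<in> lists S" using uz(2) by auto
  then have "artin_length x + artin_length (rev_complement m x) = length (u @ z)"
    unfolding uz(5) by (simp only: uz(4) uz(1) artin_length_class length_rev length_append)
  then show ?thesis by (simp only: braid_equiv_length[OF uz(3)] length_garside_power)
qed

end

theorem mainTheorem1:
  fixes W :: "('a, 'b) monoid_scheme" and S :: "'a set" and m :: nat
  assumes "coxeter_system W S" and "finite (carrier W)"
  shows "lattice (m_weak_order W S m) \<and>
    rank_symmetric (m_weak_order W S m) artin_length
      (m * coxeter_length W S (longest_element W S)) \<and>
    self_dual (m_weak_order W S m)"
proof -
  interpret finite_coxeter_system W S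
    using assms by (simp add: finite_coxeter_system_def finite_coxeter_system_axioms_def)
  let ?f = "rev_complement m"
  note involution = rev_complement_closed[of _ m] rev_complement_involution[of _ m]
  note duality = lattice_of_joins_and_antitone_involution[where f = ?f,
      OF partial_order_m_weak_order m_weak_order_joins involution rev_complement_antitone]
  have "rank_symmetric (m_weak_order W S m) artin_length
      (m * coxeter_length W S (longest_element W S))"
    by (rule rank_symmetric_of_involution[where f = ?f]) (fact involution rev_complement_length)+
  then show ?thesis using duality by blast
qed

end
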